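(* Let $p,q\ge1$ be integers and $\sigma_1,\sigma_2\in\{\pm1\}$ with $(p,\sigma_1)\neq(1,1)$. If the weight $w=p+q$ and the integer $\frac{1+\sigma_2}{2}$ have the same parity, then the double $T$-value $T(p,q;\sigma_1,\sigma_2)$ is reducible to combinations of (i.e. is a polynomial with rational coefficients in) $\pi$, $G$, the zeta values $\zeta(3),\zeta(5),\ldots$, and the Dirichlet beta values $\beta(4),\beta(6),\ldots$.
   Context: The (alternating) Kaneko-Tsumura double $T$-values are $T(p,q;\sigma_1,\sigma_2)=4\sum_{n_1>n_2\ge1}\frac{\sigma_1^{n_1}\sigma_2^{n_2}}{(2n_1-2)^{p}(2n_2-1)^{q}}$, the sum over $n_1$ being outermost (limit of partial sums). $\beta(s)=\sum_{n\ge1}\frac{(-1)^{n-1}}{(2n-1)^s}$ is the Dirichlet beta function and $G=\beta(2)$ is Catalan's constant. *)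

theory Defs
  imports "HOL-Analysis.Analysis" "HOL-Library.Poly_Mapping"
begin

text \<open>
  The truncation keeps the outer index \<open>n1 \<le> N\<close> and the full finite inner sum; for \<open>n1 = 1\<close>
  the inner sum is empty, so the vanishing denominator \<open>(2 * n1 - 2) ^ p\<close> never contributes.
\<close>

definition double_T_partial :: "nat \<Rightarrow> nat \<Rightarrow> int \<Rightarrow> int \<Rightarrow> nat \<Rightarrow> real" where
  "double_T_partial p q \<sigma>1 \<sigma>2 N =
     4 * (\<Sum>n1=1..N. \<Sum>n2=1..<n1.
            (of_int \<sigma>1 ^ n1 * of_int \<sigma>2 ^ n2) /
            ((2 * real n1 - 2) ^ p * (2 * real n2 - 1) ^ q))"

text \<open>
  \<^const>\<open>lim\<close> yields an unspecified value for divergent sequences.  For positive \<open>p\<close>, \<open>q\<close> and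
  signs \<open>\<sigma>1\<close>, \<open>\<sigma>2\<close> the partial sums converge, in general only conditionally,
  unless \<open>p = 1\<close> and \<open>\<sigma>1 = 1\<close>.
\<close>

definition double_T :: "nat \<Rightarrow> nat \<Rightarrow> int \<Rightarrow> int \<Rightarrow> real" where
  "double_T p q \<sigma>1 \<sigma>2 = lim (double_T_partial p q \<sigma>1 \<sigma>2)"

text \<open>The following two series are indexed from \<open>0\<close> rather than \<open>1\<close>.\<close>

definition zeta_value :: "nat \<Rightarrow> real" where
  "zeta_value s = suminf (\<lambda>n. 1 / (real n + 1) ^ s)"

definition dirichlet_beta :: "nat \<Rightarrow> real" where
  "dirichlet_beta s = suminf (\<lambda>n. (- 1) ^ n / (2 * real n + 1) ^ s)"

definition catalan_const :: real where
  "catalan_const = dirichlet_beta 2"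

text \<open>
  A polynomial over the rationals in indeterminates of type \<open>'v\<close> is a finitely supported map from
  monomials to coefficients, a monomial being a finitely supported map from indeterminates to
  exponents.
\<close>

type_synonym 'v rat_mpoly = "('v \<Rightarrow>\<^sub>0 nat) \<Rightarrow>\<^sub>0 rat"

definition mpoly_vars :: "'v rat_mpoly \<Rightarrow> 'v set" where
  "mpoly_vars P = (\<Union>m\<in>Poly_Mapping.keys P. Poly_Mapping.keys m)"

definition mpoly_eval :: "('v \<Rightarrow> real) \<Rightarrow> 'v rat_mpoly \<Rightarrow> real" where
  "mpoly_eval f P =
     (\<Sum>m\<in>Poly_Mapping.keys P. of_rat (Poly_Mapping.lookup P m) *
        (\<Prod>v\<in>Poly_Mapping.keys m. f v ^ Poly_Mapping.lookup m v))"

text \<open>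
  Real numbers themselves serve as names of the indeterminates, and each one is evaluated at itself.
\<close>

definition is_rat_poly_in :: "real \<Rightarrow> real set \<Rightarrow> bool" where
  "is_rat_poly_in x S \<longleftrightarrow>
     (\<exists>P :: real rat_mpoly. mpoly_vars P \<subseteq> S \<and> x = mpoly_eval (\<lambda>v. v) P)"

end

theory Submission
  imports Defs
begin

text \<open>
  Let \<open>h n\<close> be the partial sums of the inner series.  They extend to a function on the integers with
  \<open>h j - h (j - 1) = \<sigma>2^j / (2 * j - 1)^q\<close> for all \<open>j\<close>, and the parity hypothesis says exactly that
  \<open>h (- m) = (-1)^p * h m\<close>.  Consider, with \<open>\<tau> = \<sigma>1 * \<sigma>2\<close>,
  the sum of \<open>\<sigma>2^n * \<tau>^m / ((2 * m)^p * (2 * n - 1 - 2 * m)^q)\<close> over \<open>1 \<le> n \<le> N\<close> and all integers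
  \<open>m \<noteq> 0\<close>.  Summing over \<open>n\<close> first gives the terms \<open>\<sigma>1^m / (2 * m)^p * (h (N - m) - h (- m))\<close>; by parity
  the contributions of \<open>h (- m)\<close> for \<open>m\<close> and \<open>- m\<close> agree and produce the double \<open>T\<close>-value, while those of
  \<open>h (N - m)\<close> are asymptotically the same as if \<open>h (N - m)\<close> were replaced by \<open>h N\<close>.  Summing over \<open>m\<close>
  first, partial fractions reduce everything to two-sided sums, which vanish or are rational
  multiples of powers of \<open>\<pi>\<close> (derivatives of the cotangent at \<open>\<pi>/2\<close> and \<open>\<pi>/4\<close>), times sums over odd
  numbers, which the parity hypothesis restricts to zeta values at odd and beta values at even
  arguments.
\<close>

subsection \<open>Rational polynomials in a set of reals\<close>

text \<open>Coefficients can cancel in a sum or vanish under scaling by zero, so the keys of the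
  result are known only up to inclusion. Evaluation over one common finite set of monomials avoids
  the distinction.\<close>

lemma mpoly_eval_superset:
  assumes "finite A" "Poly_Mapping.keys P \<subseteq> A"
  shows "mpoly_eval f P = (\<Sum>m\<in>A. of_rat (Poly_Mapping.lookup P m) *
           (\<Prod>v\<in>Poly_Mapping.keys m. f v ^ Poly_Mapping.lookup m v))"
  unfolding mpoly_eval_def using assms
  by (intro sum.mono_neutral_left) (auto simp: in_keys_iff)

lemma is_rat_poly_in_add:
  assumes "is_rat_poly_in x S" "is_rat_poly_in y S"
  shows "is_rat_poly_in (x + y) S"
proof -
  obtain P Q :: "real rat_mpoly" where P: "mpoly_vars P \<subseteq> S" "x = mpoly_eval (\<lambda>v. v) P"
    and Q: "mpoly_vars Q \<subseteq> S" "y = mpoly_eval (\<lambda>v. v) Q"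
    using assms unfolding is_rat_poly_in_def by blast
  let ?A = "Poly_Mapping.keys P \<union> Poly_Mapping.keys Q"
  have sub: "Poly_Mapping.keys (P + Q) \<subseteq> ?A"
    by (rule keys_add)
  then have "mpoly_eval (\<lambda>v. v) (P + Q) = x + y"
    unfolding P Q by (subst (1 2 3) mpoly_eval_superset[of ?A])
      (auto simp: lookup_add of_rat_add algebra_simps sum.distrib)
  moreover have "mpoly_vars (P + Q) \<subseteq> S"
    using sub P(1) Q(1) unfolding mpoly_vars_def by blast
  ultimately show ?thesis
    unfolding is_rat_poly_in_def by metis
qed

lemma is_rat_poly_in_monomial:
  assumes "c \<in> \<rat>" "a \<in> S" "b \<in> S"
  shows "is_rat_poly_in (c * a ^ i * b ^ j) S"
proof -
  obtain r where r: "c = of_rat r"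
    using assms by (auto elim: Rats_cases)
  \<comment> \<open>The exponents are added rather than assigned, so that \<open>a = b\<close> is
    covered with exponent \<open>i + j\<close>.\<close>
  define m :: "real \<Rightarrow>\<^sub>0 nat" where "m = Poly_Mapping.single a i + Poly_Mapping.single b j"
  have keys: "Poly_Mapping.keys m \<subseteq> {a, b}"
    unfolding m_def by (rule order.trans[OF keys_add]) auto
  have "(\<Prod>v\<in>Poly_Mapping.keys m. v ^ Poly_Mapping.lookup m v)
      = (\<Prod>v\<in>{a, b}. v ^ Poly_Mapping.lookup m v)"
    using keys by (intro prod.mono_neutral_left) (auto simp: in_keys_iff)
  also have "\<dots> = a ^ i * b ^ j"
    by (cases "a = b") (simp_all add: m_def lookup_add lookup_single power_add)
  finally have "mpoly_eval (\<lambda>v. v) (Poly_Mapping.single m r) = c * a ^ i * b ^ j"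
    by (auto simp: mpoly_eval_def r)
  moreover have "mpoly_vars (Poly_Mapping.single m r) \<subseteq> S"
    using keys assms by (auto simp: mpoly_vars_def)
  ultimately show ?thesis
    unfolding is_rat_poly_in_def by metis
qed

lemma is_rat_poly_in_scale:
  assumes "c \<in> \<rat>" "is_rat_poly_in x S"
  shows "is_rat_poly_in (c * x) S"
proof -
  obtain r where r: "c = of_rat r"
    using assms by (auto elim: Rats_cases)
  obtain P :: "real rat_mpoly" where P: "mpoly_vars P \<subseteq> S" "x = mpoly_eval (\<lambda>v. v) P"
    using assms unfolding is_rat_poly_in_def by blast
  define Q where "Q = Poly_Mapping.map ((*) r) P"
  have lookup: "Poly_Mapping.lookup Q m = r * Poly_Mapping.lookup P m" for m
    by (simp add: Q_def Poly_Mapping.map.rep_eq when_def)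
  then have keys: "Poly_Mapping.keys Q \<subseteq> Poly_Mapping.keys P"
    by (auto simp: in_keys_iff)
  then have "mpoly_eval (\<lambda>v. v) Q = c * x"
    unfolding P(2) by (subst (1 2) mpoly_eval_superset[of "Poly_Mapping.keys P"])
      (simp_all add: lookup of_rat_mult r sum_distrib_left mult_ac)
  moreover have "mpoly_vars Q \<subseteq> S"
    using keys P(1) unfolding mpoly_vars_def by blast
  ultimately show ?thesis
    unfolding is_rat_poly_in_def by metis
qed

text \<open>Induction with 1/(x^p y^q) = (1/(x^(p-1) y^q) + 1/(x^p y^(q-1)))/(x+y), until one
  exponent is 0. The coefficient at \<open>i = p\<close> is recorded because that term leads to the
  sum over \<open>1 / (2 * n - 1) ^ q\<close>, which diverges for \<open>q = 1\<close> without signs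
  and then has to be cancelled exactly.\<close>

lemma partial_fractions_powers:
  assumes "p + q \<ge> 1"
  shows "\<exists>(c :: nat \<Rightarrow> nat) (d :: nat \<Rightarrow> nat). c p = (1::nat) \<and>
    (\<forall>x y :: real. x \<noteq> 0 \<longrightarrow> y \<noteq> 0 \<longrightarrow> x + y \<noteq> 0 \<longrightarrow>
      1 / (x ^ p * y ^ q) =
        (\<Sum>i=1..p. c i / (x ^ i * (x + y) ^ (p + q - i))) +
        (\<Sum>i=1..q. d i / (y ^ i * (x + y) ^ (p + q - i))))"
  using assms
proof (induction "p + q" arbitrary: p q rule: less_induct)
  case less
  consider "p = 0" | "q = 0" "p > 0" | "p > 0" "q > 0"
    by auto
  then show ?case
  proof cases
    case 1
    define d :: "nat \<Rightarrow> nat" where "d i = (if i = q then 1 else 0)" for i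
    have "(\<Sum>i=1..q. d i / (y ^ i * (x + y) ^ (p + q - i))) = 1 / y ^ q" for x y :: real
    proof -
      have "(\<Sum>i=1..q. d i / (y ^ i * (x + y) ^ (p + q - i)))
          = (\<Sum>i\<in>{q}. d i / (y ^ i * (x + y) ^ (p + q - i)))"
        using less.prems 1 by (intro sum.mono_neutral_right) (auto simp: d_def)
      then show ?thesis
        using 1 by (simp add: d_def)
    qed
    then show ?thesis
      using 1 by (intro exI[of _ "\<lambda>_. 1"] exI[of _ d]) simp
  next
    case 2
    define c :: "nat \<Rightarrow> nat" where "c i = (if i = p then 1 else 0)" for i
    have "(\<Sum>i=1..p. c i / (x ^ i * (x + y) ^ (p + q - i))) = 1 / x ^ p" for x y :: real
    proof -
      have "(\<Sum>i=1..p. c i / (x ^ i * (x + y) ^ (p + q - i)))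
          = (\<Sum>i\<in>{p}. c i / (x ^ i * (x + y) ^ (p + q - i)))"
        using 2 by (intro sum.mono_neutral_right) (auto simp: c_def)
      then show ?thesis
        using 2 by (simp add: c_def)
    qed
    moreover have "c p = 1"
      by (simp add: c_def)
    ultimately show ?thesis
      using 2 by (intro exI[of _ c] exI[of _ "\<lambda>_. 0"]) simp
  next
    case 3
    obtain c1 d1 :: "nat \<Rightarrow> nat" where 1: "\<And>x y :: real. x \<noteq> 0 \<Longrightarrow> y \<noteq> 0 \<Longrightarrow> x + y \<noteq> 0 \<Longrightarrow>
      1 / (x ^ (p-1) * y ^ q) =
        (\<Sum>i=1..p-1. c1 i / (x ^ i * (x + y) ^ (p - 1 + q - i))) +
        (\<Sum>i=1..q. d1 i / (y ^ i * (x + y) ^ (p - 1 + q - i)))"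
      using less.hyps[of "p - 1" q] 3 by force
    obtain c2 d2 :: "nat \<Rightarrow> nat" where 2: "c2 p = 1" "\<And>x y :: real. x \<noteq> 0 \<Longrightarrow> y \<noteq> 0 \<Longrightarrow> x + y \<noteq> 0 \<Longrightarrow>
      1 / (x ^ p * y ^ (q - 1)) =
        (\<Sum>i=1..p. c2 i / (x ^ i * (x + y) ^ (p + (q - 1) - i))) +
        (\<Sum>i=1..q-1. d2 i / (y ^ i * (x + y) ^ (p + (q - 1) - i)))"
      using less.hyps[of p "q - 1"] 3 by force
    \<comment> \<open>The expansion for \<open>p - 1\<close> has no term at \<open>i = p\<close> and
      the one for \<open>q - 1\<close> none at \<open>i = q\<close>; the meaningless values of
      \<open>c1\<close> and \<open>d2\<close> there are masked. Hence
      \<open>c p = c2 p\<close>.\<close>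
    define c where "c i = (if i = p then 0 else c1 i) + c2 i" for i
    define d where "d i = d1 i + (if i = q then 0 else d2 i)" for i
    have "1 / (x ^ p * y ^ q) =
        (\<Sum>i=1..p. c i / (x ^ i * (x + y) ^ (p + q - i))) +
        (\<Sum>i=1..q. d i / (y ^ i * (x + y) ^ (p + q - i)))"
      if nz: "x \<noteq> 0" "y \<noteq> 0" "x + y \<noteq> 0" for x y :: real
    proof -
      let ?k = "x + y"
      have shift: "z / (w * ?k ^ (p + q - 1 - i)) / ?k = z / (w * ?k ^ (p + q - i))"
        if "i < p + q" for i z and w :: real
      proof -
        have "p + q - i = Suc (p + q - 1 - i)"
          using that by auto
        then show ?thesis
          by (simp add: divide_divide_eq_left mult_ac)
      qed
      have P: "p = Suc (p - 1)" and Q: "q = Suc (q - 1)"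
        using 3 by auto
      have "1 / (x ^ p * y ^ q) = (1 / (x ^ (p-1) * y ^ q) + 1 / (x ^ p * y ^ (q-1))) / ?k"
      proof -
        have "x ^ p = x * x ^ (p - 1)" "y ^ q = y * y ^ (q - 1)"
          using P Q by (metis power_Suc)+
        then show ?thesis
          using nz by (simp add: divide_simps) (simp add: algebra_simps)?
      qed
      also have "\<dots> = 1 / (x ^ (p-1) * y ^ q) / ?k + 1 / (x ^ p * y ^ (q-1)) / ?k"
        by (rule add_divide_distrib)
      also have "1 / (x ^ (p-1) * y ^ q) / ?k =
          (\<Sum>i=1..p-1. c1 i / (x ^ i * ?k ^ (p + q - i))) +
          (\<Sum>i=1..q. d1 i / (y ^ i * ?k ^ (p + q - i)))"
      proof -
        have e: "p - 1 + q - i = p + q - 1 - i" for i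
          using 3 by auto
        show ?thesis
          unfolding 1[OF nz] e add_divide_distrib sum_divide_distrib
          using 3 by (intro arg_cong2[where f = "(+)"] sum.cong refl shift) auto
      qed
      also have "1 / (x ^ p * y ^ (q-1)) / ?k =
          (\<Sum>i=1..p. c2 i / (x ^ i * ?k ^ (p + q - i))) +
          (\<Sum>i=1..q-1. d2 i / (y ^ i * ?k ^ (p + q - i)))"
      proof -
        have e: "p + (q - 1) - i = p + q - 1 - i" for i
          using 3 by auto
        show ?thesis
          unfolding 2(2)[OF nz] e add_divide_distrib sum_divide_distrib
          using 3 by (intro arg_cong2[where f = "(+)"] sum.cong refl shift) auto
      qed
      also have "(\<Sum>i=1..p-1. c1 i / (x ^ i * ?k ^ (p + q - i)))
          = (\<Sum>i=1..p. (if i = p then 0 else c1 i) / (x ^ i * ?k ^ (p + q - i)))"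
        by (intro sum.mono_neutral_cong_left) auto
      also have "(\<Sum>i=1..q-1. d2 i / (y ^ i * ?k ^ (p + q - i)))
          = (\<Sum>i=1..q. (if i = q then 0 else d2 i) / (y ^ i * ?k ^ (p + q - i)))"
        by (intro sum.mono_neutral_cong_left) auto
      finally show ?thesis
        unfolding c_def d_def by (simp add: add_divide_distrib sum.distrib)
    qed
    moreover have "c p = 1"
      using 2(1) by (simp add: c_def)
    ultimately show ?thesis
      by blast
  qed
qed

subsection \<open>Series with values in the rational multiples of powers of pi\<close>

text \<open>By Euler's reflection formula the product Gamma(t) Gamma(1-t) sin(pi t) is constant on
  the open unit interval, so its derivative vanishes; dividing by the positive factors gives the
  claim.\<close>

lemma Digamma_reflection_real:
  fixes z :: real
  assumes z: "0 < z" "z < 1"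
  shows "Digamma (1 - z) - Digamma z = pi * cot (pi * z)"
proof -
  have reflection: "Gamma t * Gamma (1 - t) * sin (pi * t) = pi" if "0 < t" "t < 1" for t :: real
  proof -
    have "complex_of_real (Gamma t * Gamma (1 - t)) = Gamma (of_real t) * Gamma (1 - of_real t)"
      using Gamma_complex_of_real[of "1 - t"] by (simp add: Gamma_complex_of_real)
    also have "\<dots> = of_real (pi / sin (pi * t))"
      by (simp add: Gamma_reflection_complex sin_of_real flip: of_real_mult)
    finally have "Gamma t * Gamma (1 - t) = pi / sin (pi * t)"
      unfolding of_real_eq_iff .
    moreover have "sin (pi * t) > 0"
      using that by (intro sin_gt_zero) auto
    ultimately show ?thesis
      by simp
  qed
  have nz: "z \<notin> \<int>\<^sub>\<le>\<^sub>0" "1 - z \<notin> \<int>\<^sub>\<le>\<^sub>0"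
    using z by (auto elim!: nonpos_Ints_cases)
  have sin_pos: "sin (pi * z) > 0"
    using z by (intro sin_gt_zero) auto
  have Gamma_pos: "Gamma z > 0" "Gamma (1 - z) > 0"
    using z by (auto intro: Gamma_real_pos)
  let ?g = "Gamma z * Gamma (1 - z)"
  have "((\<lambda>t. Gamma t * Gamma (1 - t) * sin (pi * t)) has_real_derivative
      ?g * ((Digamma z - Digamma (1 - z)) * sin (pi * z) + pi * cos (pi * z))) (at z)"
    using nz by (auto intro!: derivative_eq_intros simp: algebra_simps)
  moreover have "((\<lambda>t. Gamma t * Gamma (1 - t) * sin (pi * t)) has_real_derivative 0) (at z)
      \<longleftrightarrow> ((\<lambda>t. pi) has_real_derivative 0) (at z)"
    using z reflection
    by (intro DERIV_cong_ev) (auto intro!: eventually_mono[OF eventually_nhds_in_open[of "{0<..<1}"]])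
  ultimately have "?g * ((Digamma z - Digamma (1 - z)) * sin (pi * z) + pi * cos (pi * z)) = 0"
    using DERIV_unique by fastforce
  then have "(Digamma z - Digamma (1 - z)) * sin (pi * z) + pi * cos (pi * z) = 0"
    using Gamma_pos by simp
  then show ?thesis
    using sin_pos by (simp add: cot_def field_simps)
qed

text \<open>The digamma reflection is differentiated \<open>i\<close> times. As the derivative of
  cot is -(1 + cot^2), polynomials in the cotangent with rational coefficients stay such
  polynomials, and the chain rule contributes one factor \<open>pi\<close> each time.\<close>

lemma Polygamma_reflection_real:
  "\<exists>P :: real poly. (\<forall>n. coeff P n \<in> \<rat>) \<and>
     (\<forall>z::real. 0 < z \<longrightarrow> z < 1 \<longrightarrow>
        (-1) ^ i * Polygamma i (1 - z) - Polygamma i z = pi ^ Suc i * poly P (cot (pi * z)))"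
proof (induction i)
  case 0
  show ?case
    by (intro exI[of _ "[:0, 1:]"]) (auto simp: Digamma_reflection_real coeff_pCons split: nat.split)
next
  case (Suc i)
  then obtain P :: "real poly" where rat: "\<And>n. coeff P n \<in> \<rat>" and
    P: "\<And>z::real. 0 < z \<Longrightarrow> z < 1 \<Longrightarrow>
      (-1) ^ i * Polygamma i (1 - z) - Polygamma i z = pi ^ Suc i * poly P (cot (pi * z))"
    by blast
  define Q where "Q = - (pderiv P * [:1, 0, 1:])"
  have "coeff Q n \<in> \<rat>" for n
    unfolding Q_def
    by (auto simp: coeff_mult coeff_pderiv coeff_pCons rat split: nat.split
             intro!: Rats_sum Rats_mult Rats_add)
  moreover have "(-1) ^ Suc i * Polygamma (Suc i) (1 - z) - Polygamma (Suc i) z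
      = pi ^ Suc (Suc i) * poly Q (cot (pi * z))" if z: "0 < z" "z < 1" for z :: real
  proof -
    have nz: "z \<notin> \<int>\<^sub>\<le>\<^sub>0" "1 - z \<notin> \<int>\<^sub>\<le>\<^sub>0"
      using z by (auto elim!: nonpos_Ints_cases)
    have sin_pos: "sin (pi * z) > 0"
      using z by (intro sin_gt_zero) auto
    have cot: "- inverse ((sin (pi * z))\<^sup>2) = - (1 + (cot (pi * z))\<^sup>2)"
      using sin_pos sin_cos_squared_add[of "pi * z"] by (simp add: cot_def field_simps)
    have "((\<lambda>t. (-1) ^ i * Polygamma i (1 - t) - Polygamma i t) has_real_derivative
        (-1) ^ Suc i * Polygamma (Suc i) (1 - z) - Polygamma (Suc i) z) (at z)"
      using nz by (auto intro!: derivative_eq_intros)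
    moreover have "((\<lambda>t. (-1) ^ i * Polygamma i (1 - t) - Polygamma i t) has_real_derivative
        pi ^ Suc (Suc i) * poly Q (cot (pi * z))) (at z) \<longleftrightarrow>
        ((\<lambda>t. pi ^ Suc i * poly P (cot (pi * t))) has_real_derivative
        pi ^ Suc (Suc i) * poly Q (cot (pi * z))) (at z)"
      using z P
      by (intro DERIV_cong_ev) (auto intro!: eventually_mono[OF eventually_nhds_in_open[of "{0<..<1}"]])
    moreover have "((\<lambda>t. pi ^ Suc i * poly P (cot (pi * t))) has_real_derivative
        pi ^ Suc (Suc i) * poly Q (cot (pi * z))) (at z)"
    proof -
      have "((\<lambda>t. cot (pi * t)) has_real_derivative - (1 + (cot (pi * z))\<^sup>2) * pi) (at z)"
        unfolding cot[symmetric]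
        using sin_pos by (intro DERIV_chain2[OF DERIV_cot]) (auto intro!: derivative_eq_intros)
      from DERIV_cmult[OF DERIV_chain2[OF poly_DERIV this], of "pi ^ Suc i" P]
      show ?thesis
        by (rule DERIV_cong) (simp add: Q_def algebra_simps power2_eq_square)
    qed
    ultimately show ?thesis
      using DERIV_unique by blast
  qed
  ultimately show ?case
    by blast
qed

text \<open>Meant for \<open>z = 1/2\<close> and \<open>z = 1/4\<close>, where the cotangent is 0
  and 1.\<close>

lemma Polygamma_reflection_rat:
  fixes z :: real
  assumes "0 < z" "z < 1" "cot (pi * z) \<in> \<rat>"
  obtains r where "r \<in> \<rat>" "(-1) ^ i * Polygamma i (1 - z) - Polygamma i z = r * pi ^ Suc i"
proof -
  obtain P :: "real poly" where P: "\<And>n. coeff P n \<in> \<rat>"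
    "(-1) ^ i * Polygamma i (1 - z) - Polygamma i z = pi ^ Suc i * poly P (cot (pi * z))"
    using Polygamma_reflection_real[of i] assms by blast
  have "poly P (cot (pi * z)) \<in> \<rat>"
    unfolding poly_altdef using P(1) assms(3) by (intro Rats_sum Rats_mult Rats_power) auto
  with P(2) that[of "poly P (cot (pi * z))"] show ?thesis
    by (simp add: mult.commute)
qed

lemma Polygamma_sums:
  fixes z :: real
  assumes "z > 0" "i > 0"
  shows "(\<lambda>k. 1 / (z + real k) ^ Suc i) sums ((-1) ^ Suc i * Polygamma i z / fact i)"
proof -
  have "(\<lambda>k. inverse ((z + real k) ^ Suc i)) sums suminf (\<lambda>k. inverse ((z + real k) ^ Suc i))"
    using Polygamma_converges'[of z "Suc i"] assms by (intro summable_sums) auto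
  moreover have "(-1) ^ Suc i * Polygamma i z / fact i = suminf (\<lambda>k. inverse ((z + real k) ^ Suc i))"
    using assms by (simp add: Polygamma_def)
  ultimately show ?thesis
    by (simp add: inverse_eq_divide)
qed

text \<open>For a sign \<open>s\<close> these are the inner sums \<open>h n\<close>. The powers
  start at \<open>s ^ 1\<close>, so for \<open>s = -1\<close> the sign is opposite to that of
  \<open>dirichlet_beta\<close>.\<close>

definition odd_psum :: "real \<Rightarrow> nat \<Rightarrow> nat \<Rightarrow> real" where
  "odd_psum s q n = (\<Sum>j=1..n. s ^ j / (2 * real j - 1) ^ q)"

lemma odd_psum_0 [simp]: "odd_psum s q 0 = 0"
  by (simp add: odd_psum_def)

lemma odd_psum_Suc [simp]: "odd_psum s q (Suc n) = odd_psum s q n + s ^ Suc n / (2 * real n + 1) ^ q"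
  by (simp add: odd_psum_def algebra_simps)

lemma odd_psum_LIMSEQ_iff:
  "odd_psum s q \<longlonglongrightarrow> L \<longleftrightarrow> (\<lambda>k. s ^ Suc k / (2 * real k + 1) ^ q) sums L"
proof -
  have "odd_psum s q = (\<lambda>n. \<Sum>k<n. s ^ Suc k / (2 * real k + 1) ^ q)"
  proof
    show "odd_psum s q n = (\<Sum>k<n. s ^ Suc k / (2 * real k + 1) ^ q)" for n
      by (induction n) auto
  qed
  then show ?thesis
    by (simp add: sums_def)
qed

lemma fact_in_Rats: "(fact n :: real) \<in> \<rat>"
  by (metis Rats_of_nat of_nat_fact)

text \<open>The point \<open>1/2\<close> is fixed by the reflection. As the order
  \<open>j = i - 1\<close> is odd, the two polygamma values there add up instead of cancelling, and
  the reflection formula determines the value itself.\<close>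

lemma odd_psum_even_power_limit:
  assumes "even i" "i > 0"
  obtains r where "r \<in> \<rat>" "odd_psum 1 i \<longlonglongrightarrow> r * pi ^ i"
proof -
  obtain j where j: "i = Suc j" "odd j"
    using assms by (cases i) auto
  then have "j > 0"
    by (auto intro: Nat.gr0I)
  have "cot (pi * (1/2)) = 0"
    by (simp add: cot_def)
  then obtain r where r: "r \<in> \<rat>"
    "(-1) ^ j * Polygamma j (1 - 1/2) - Polygamma j (1/2) = r * pi ^ Suc j"
    using Polygamma_reflection_rat[where z = "1/2" and i = j] by auto
  then have half: "Polygamma j (1/2) = - (r / 2) * pi ^ i"
    using j by simp
  have "(\<lambda>k. (1/2) ^ i * (1 / (1/2 + real k) ^ Suc j)) sums
      ((1/2) ^ i * ((-1) ^ Suc j * Polygamma j (1/2) / fact j))"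
    by (intro sums_mult Polygamma_sums \<open>j > 0\<close>) auto
  moreover have "(1/2) ^ i * (1 / (1/2 + real k) ^ Suc j) = 1 ^ Suc k / (2 * real k + 1) ^ i" for k
  proof -
    have "2 ^ i * (1/2 + real k) ^ i = (2 * real k + 1) ^ i"
      by (simp add: power_mult_distrib[symmetric] algebra_simps)
    then show ?thesis
      by (simp add: j(1)[symmetric] power_one_over)
  qed
  ultimately have "odd_psum 1 i \<longlonglongrightarrow> (1/2) ^ i * (-1) ^ Suc j * (- (r / 2)) / fact j * pi ^ i"
    unfolding odd_psum_LIMSEQ_iff half by (simp add: mult_ac)
  moreover have "(1/2) ^ i * (-1) ^ Suc j * (- (r / 2)) / fact j \<in> \<rat>"
    using r(1) fact_in_Rats by (simp add: Rats_divide)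
  ultimately show ?thesis
    using that by blast
qed

text \<open>Pairing consecutive terms gives a difference of polygamma series at \<open>3/4\<close>
  and \<open>1/4\<close>. The reflection exchanges these points, and for even order
  \<open>j = i - 1\<close> it evaluates just this difference.\<close>

lemma odd_psum_alternating_odd_power_limit:
  assumes "odd i"
  obtains r where "r \<in> \<rat>" "odd_psum (-1) i \<longlonglongrightarrow> r * pi ^ i"
proof (cases "i = 1")
  case True
  \<comment> \<open>The case \<open>i = 1\<close> is Leibniz's series for \<open>pi / 4\<close>;
    \<open>Polygamma_sums\<close> covers positive order only.\<close>
  have "(\<lambda>k. (-1) ^ k * (1 / real (k * 2 + 1) * 1 ^ (k * 2 + 1))) sums arctan 1"
    using summable_arctan_series[of 1, THEN summable_sums] by (subst arctan_series) auto
  from sums_minus[OF this] have "odd_psum (-1) i \<longlonglongrightarrow> (- 1 / 4) * pi ^ i"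
    unfolding odd_psum_LIMSEQ_iff True by (simp add: ac_simps arctan_one)
  then show ?thesis
    by (rule that[rotated]) auto
next
  case False
  then obtain j where j: "i = Suc j" "even j" "j > 0"
    using assms by (cases i) auto
  have "cot (pi * (1/4)) = 1"
    using tan_45 by (simp add: cot_altdef)
  then obtain r where r: "r \<in> \<rat>"
    "(-1) ^ j * Polygamma j (1 - 1/4) - Polygamma j (1/4) = r * pi ^ Suc j"
    using Polygamma_reflection_rat[where z = "1/4" and i = j] by auto
  define A where "A = (\<lambda>z::real. (-1) ^ Suc j * Polygamma j z / fact j)"
  have diff: "A (3/4) - A (1/4) = - r / fact j * pi ^ i"
  proof -
    have "Polygamma j (1/4) - Polygamma j (3/4) = - r * pi ^ i"
      using r(2) j by simp
    then show ?thesis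
      using j by (simp add: A_def flip: diff_divide_distrib)
  qed
  have "(\<lambda>k. (1/4) ^ i * (1 / (3/4 + real k) ^ Suc j - 1 / (1/4 + real k) ^ Suc j)) sums
      ((1/4) ^ i * (A (3/4) - A (1/4)))"
    unfolding A_def by (intro sums_mult sums_diff Polygamma_sums \<open>j > 0\<close>) auto
  moreover have "(1/4) ^ i * (1 / (3/4 + real k) ^ Suc j - 1 / (1/4 + real k) ^ Suc j)
      = 1 / (4 * real k + 3) ^ i - 1 / (4 * real k + 1) ^ i" for k
  proof -
    have "4 ^ i * (3/4 + real k) ^ i = (4 * real k + 3) ^ i"
      "4 ^ i * (1/4 + real k) ^ i = (4 * real k + 1) ^ i"
      by (simp_all add: power_mult_distrib[symmetric] algebra_simps)
    then show ?thesis
      by (simp add: j(1)[symmetric] power_one_over algebra_simps)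
  qed
  ultimately have paired: "(\<lambda>k. 1 / (4 * real k + 3) ^ i - 1 / (4 * real k + 1) ^ i) sums
      ((1/4) ^ i * (- r / fact j) * pi ^ i)"
    unfolding diff by (simp add: mult_ac)
  let ?f = "\<lambda>k. (-1) ^ Suc k / (2 * real k + 1) ^ i"
  \<comment> \<open>Absolute convergence first provides some limit \<open>L\<close>; grouping in
    pairs then identifies it.\<close>
  have "summable (\<lambda>k. 1 / (1 + real k) ^ i)"
    using Polygamma_converges'[of "1::real" i] j by (simp add: inverse_eq_divide)
  then have "summable ?f"
    by (rule summable_comparison_test'[where N = 0])
      (auto simp: norm_divide norm_power power_abs intro!: divide_left_mono power_mono)
  then obtain L where L: "?f sums L"
    by blast
  have "sum ?f {k * 2..<k * 2 + 2} = 1 / (4 * real k + 3) ^ i - 1 / (4 * real k + 1) ^ i" for k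
  proof -
    have "{k * 2..<k * 2 + 2} = {k * 2, k * 2 + 1}"
      by auto
    then show ?thesis
      by (simp add: ac_simps)
  qed
  with sums_group[OF L, of 2] have "(\<lambda>k. 1 / (4 * real k + 3) ^ i - 1 / (4 * real k + 1) ^ i) sums L"
    by simp
  from sums_unique2[OF this paired] L
  have "odd_psum (-1) i \<longlonglongrightarrow> (1/4) ^ i * (- r / fact j) * pi ^ i"
    unfolding odd_psum_LIMSEQ_iff by simp
  moreover have "(1/4) ^ i * (- r / fact j) \<in> \<rat>"
    using r(1) fact_in_Rats by (simp add: Rats_divide)
  ultimately show ?thesis
    using that by blast
qed

subsection \<open>Two-sided sums\<close>

text \<open>
  The values at negative arguments are chosen so that the difference equation of \<open>odd_psum\<close> holds on
  all integers.
\<close>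

definition odd_isum :: "real \<Rightarrow> nat \<Rightarrow> int \<Rightarrow> real" where
  "odd_isum s q j =
     (if j \<ge> 0 then odd_psum s q (nat j) else - s * (-1) ^ q * odd_psum s q (nat (- j)))"

lemma odd_isum_of_nat [simp]: "odd_isum s q (int n) = odd_psum s q n"
  by (simp add: odd_isum_def)

text \<open>Under the parity hypothesis of the theorem the factor is \<open>(-1) ^ p\<close>, the
  sign that \<open>(2 * m) ^ p\<close> acquires when \<open>m\<close> is negated.\<close>

lemma odd_isum_minus:
  assumes "s \<in> {1, -1}"
  shows "odd_isum s q (- j) = - s * (-1) ^ q * odd_isum s q j"
  using assms by (cases j "0::int" rule: linorder_cases) (auto simp: odd_isum_def)

lemma sign_powi:
  fixes s :: real
  assumes "s \<in> {1, -1}"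
  shows "s powi (- j) = s powi j" "s powi j * s powi j = 1"
proof -
  show minus: "s powi (- j) = s powi j"
    using assms by (auto simp: power_int_minus power_int_inverse[symmetric])
  have "s powi j * s powi (- j) = 1"
    using assms by (subst power_int_add[symmetric]) auto
  then show "s powi j * s powi j = 1"
    unfolding minus .
qed

text \<open>Replacing \<open>j\<close> by \<open>1 - j\<close> negates \<open>2 * j - 1\<close> and
  multiplies the sign power by \<open>s\<close>. The factor in \<open>odd_isum\<close> at negative
  arguments accounts for both, its minus sign for summing backwards from 0.\<close>

lemma odd_isum_step:
  assumes s: "s \<in> {1, -1}"
  shows "odd_isum s q j = odd_isum s q (j - 1) + s powi j / (2 * of_int j - 1) ^ q"
proof (cases "j \<ge> 1")
  case True
  then obtain n where j: "j = int (Suc n)"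
    by (metis Suc_le_D of_nat_1 nonneg_int_cases of_nat_le_iff One_nat_def zero_le_one order_trans)
  have "j - 1 = int n"
    by (simp add: j)
  then show ?thesis
    unfolding j by (simp only: odd_isum_of_nat) (simp add: power_int_of_nat[of s "Suc n", simplified] add_ac)
next
  case False
  then obtain n where j: "j = - int n"
    by (intro that[of "nat (- j)"]) auto
  have "j - 1 = - int (Suc n)"
    by (simp add: j)
  then have "odd_isum s q (j - 1) = - s * (-1) ^ q * odd_psum s q (Suc n)"
    by (simp only: odd_isum_minus[OF s] odd_isum_of_nat)
  also have "\<dots> = - s * (-1) ^ q * odd_psum s q n - s * (-1) ^ q * (s * s ^ n) / (2 * real n + 1) ^ q"
    by (simp add: algebra_simps)
  also have "- s * (-1) ^ q * odd_psum s q n = odd_isum s q j"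
    by (simp only: j odd_isum_minus[OF s] odd_isum_of_nat)
  also have "s * (-1) ^ q * (s * s ^ n) / (2 * real n + 1) ^ q = s powi j / (2 * of_int j - 1) ^ q"
  proof -
    have "2 * of_int j - 1 = (-1) * (2 * real n + 1)"
      by (simp add: j)
    then have "(2 * of_int j - 1) ^ q = (-1) ^ q * (2 * real n + 1) ^ q"
      by (metis power_mult_distrib)
    moreover have "s powi j = s ^ n"
      unfolding j sign_powi(1)[OF s] by simp
    ultimately show ?thesis
      using s by (auto simp: divide_simps minus_one_power_iff)
  qed
  finally show ?thesis
    by simp
qed

text \<open>With \<open>j = n - m\<close> the terms are increments of \<open>odd_isum\<close>, so
  the sum telescopes between \<open>- m\<close> and \<open>N - m\<close>.\<close>

lemma shifted_odd_sum:
  assumes s: "s \<in> {1, -1}"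
  shows "(\<Sum>n=1..N. s ^ n / (2 * real n - 1 - 2 * of_int m) ^ q)
       = s powi m * (odd_isum s q (int N - m) - odd_isum s q (- m))"
proof (induction N)
  case 0
  then show ?case by simp
next
  case (Suc N)
  let ?j = "int (Suc N) - m"
  have [simp]: "s \<noteq> 0"
    using s by auto
  have "s powi m * s powi ?j = s ^ Suc N"
    by (subst power_int_add[symmetric]) (auto simp: power_int_of_nat[of s "Suc N", simplified])
  moreover have "2 * real (Suc N) - 1 - 2 * of_int m = 2 * of_int ?j - 1"
    by simp
  ultimately have "s ^ Suc N / (2 * real (Suc N) - 1 - 2 * of_int m) ^ q
      = s powi m * (s powi ?j / (2 * of_int ?j - 1) ^ q)"
    by (metis times_divide_eq_right)
  also have "s powi ?j / (2 * of_int ?j - 1) ^ q = odd_isum s q ?j - odd_isum s q (int N - m)"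
    using odd_isum_step[OF s, of q ?j] by (simp add: algebra_simps)
  finally show ?case
    using Suc.IH by (simp add: algebra_simps)
qed

text \<open>Once the term \<open>m = 0\<close> is added, the denominators run through the
  consecutive odd numbers \<open>2 * j - 1\<close> with \<open>j\<close> from \<open>n - M\<close>
  to \<open>n + M\<close>, and the sum telescopes. The subtracted fraction is that missing
  term.\<close>

lemma two_sided_odd_sum:
  assumes s: "s \<in> {1, -1}"
  shows "(\<Sum>m=1..M. s ^ m / (2 * real n - 1 - 2 * real m) ^ i + s ^ m / (2 * real n - 1 + 2 * real m) ^ i)
       = s ^ n * (odd_isum s i (int n + int M) - odd_isum s i (int n - int M - 1)) - 1 / (2 * real n - 1) ^ i"
proof (induction M)
  case 0
  have "s ^ n * s ^ n = 1"
    using sign_powi(2)[OF s, of "int n"] by simp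
  then show ?case
    using odd_isum_step[OF s, of i "int n"] by (simp add: algebra_simps)
next
  case (Suc M)
  have nz [simp]: "s \<noteq> 0"
    using s by auto
  have sq: "s ^ n * s ^ n = 1"
    using sign_powi(2)[OF s, of "int n"] by simp
  have "s powi (int n - int M - 1) = s powi (int n + - int (Suc M))"
    by (rule arg_cong[where f = "\<lambda>x. s powi x"]) simp
  also have "\<dots> = s ^ n * s ^ Suc M"
    by (simp only: power_int_add nz simp_thms disj_not1 sign_powi(1)[OF s] power_int_of_nat)
  finally have lo: "s ^ n * s powi (int n - int M - 1) = s ^ Suc M"
    by (simp add: mult.assoc[symmetric] sq)
  have "s powi (int n + int (Suc M)) = s ^ n * s ^ Suc M"
    by (simp only: power_int_add nz simp_thms disj_not1 power_int_of_nat)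
  then have hi: "s ^ n * s powi (int n + int (Suc M)) = s ^ Suc M"
    by (simp add: mult.assoc[symmetric] sq)
  have 1: "odd_isum s i (int n + int (Suc M)) = odd_isum s i (int n + int M) +
      s powi (int n + int (Suc M)) / (2 * real n - 1 + 2 * real (Suc M)) ^ i"
    using odd_isum_step[OF s, of i "int n + int (Suc M)"] by (simp add: algebra_simps)
  have 2: "odd_isum s i (int n - int M - 1) = odd_isum s i (int n - int (Suc M) - 1) +
      s powi (int n - int M - 1) / (2 * real n - 1 - 2 * real (Suc M)) ^ i"
    using odd_isum_step[OF s, of i "int n - int M - 1"] by (simp add: algebra_simps)
  have "s ^ n * (odd_isum s i (int n + int (Suc M)) - odd_isum s i (int n - int (Suc M) - 1))
      = s ^ n * (odd_isum s i (int n + int M) - odd_isum s i (int n - int M - 1))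
       + s ^ n * s powi (int n + int (Suc M)) / (2 * real n - 1 + 2 * real (Suc M)) ^ i
       + s ^ n * s powi (int n - int M - 1) / (2 * real n - 1 - 2 * real (Suc M)) ^ i"
    unfolding 1 2 by (simp only: ring_distribs times_divide_eq_right)
  then show ?case
    unfolding hi lo using Suc.IH by (simp only: sum.cl_ivl_Suc) (simp del: of_nat_Suc power_Suc)
qed

text \<open>Only the terms have to tend to 0, so this covers \<open>s = 1\<close>,
  \<open>q = 1\<close>, where the sums themselves diverge.\<close>

lemma odd_psum_shift_diff:
  assumes s: "s \<in> {1, -1}" and "q \<ge> 1"
  shows "(\<lambda>n. odd_psum s q (n + a) - odd_psum s q n) \<longlonglongrightarrow> 0"
proof (induction a)
  case 0
  then show ?case by simp
next
  case (Suc a)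
  have "(\<lambda>n. s ^ Suc (n + a) / (2 * real (n + a) + 1) ^ q) \<longlonglongrightarrow> 0"
  proof (rule Lim_null_comparison)
    have "norm (s ^ Suc (n + a) / (2 * real (n + a) + 1) ^ q) \<le> 1 / real (Suc n)" for n
    proof -
      have "real (Suc n) \<le> 2 * real (n + a) + 1"
        by simp
      also have "\<dots> \<le> (2 * real (n + a) + 1) ^ q"
        using \<open>q \<ge> 1\<close> by (intro self_le_power) auto
      finally have "1 / (2 * real (n + a) + 1) ^ q \<le> 1 / real (Suc n)"
        by (intro divide_left_mono) auto
      moreover have "\<bar>s\<bar> = 1"
        using s by auto
      ultimately show ?thesis
        by (simp add: norm_divide norm_power abs_mult power_abs)
    qed
    then show "\<forall>\<^sub>F n in sequentially. norm (s ^ Suc (n + a) / (2 * real (n + a) + 1) ^ q) \<le> 1 / real (Suc n)"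
      by simp
  qed (rule LIMSEQ_Suc[OF lim_inverse_n'])
  from tendsto_add[OF Suc this] show ?case
    by (simp add: algebra_simps)
qed

text \<open>The two ends of the telescoped sum combine with the factor \<open>s * (-1) ^ i\<close>.
  If it is -1 they cancel asymptotically, even where each of them diverges; if it is 1, each end
  tends to a rational multiple of \<open>pi ^ i\<close>.\<close>

lemma two_sided_odd_sum_limit:
  assumes s: "s \<in> {1, -1}" and "i \<ge> 1"
  shows "\<exists>r. r \<in> \<rat> \<and> (s * (-1) ^ i \<noteq> 1 \<longrightarrow> r = 0) \<and> (\<forall>n.
    (\<lambda>M. \<Sum>m=1..M. s ^ m / (2 * real n - 1 - 2 * real m) ^ i + s ^ m / (2 * real n - 1 + 2 * real m) ^ i)
      \<longlonglongrightarrow> s ^ n * (r * pi ^ i) - 1 / (2 * real n - 1) ^ i)"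
proof -
  have lim: "\<exists>r. r \<in> \<rat> \<and> (s * (-1) ^ i \<noteq> 1 \<longrightarrow> r = 0) \<and> (\<forall>n.
    (\<lambda>M. odd_psum s i (M + 2 * n) + s * (-1) ^ i * odd_psum s i (M + 1)) \<longlonglongrightarrow> r * pi ^ i)"
  proof (cases "s * (-1) ^ i = 1")
    case True
    then have "s = 1 \<and> even i \<or> s = -1 \<and> odd i"
      using s by (auto simp: minus_one_power_iff split: if_splits)
    then obtain r where r: "r \<in> \<rat>" "odd_psum s i \<longlonglongrightarrow> r * pi ^ i"
      using odd_psum_even_power_limit[of i thesis] odd_psum_alternating_odd_power_limit[of i thesis]
        \<open>i \<ge> 1\<close> by auto
    have "(\<lambda>M. odd_psum s i (M + 2 * n) + s * (-1) ^ i * odd_psum s i (M + 1))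
        \<longlonglongrightarrow> r * pi ^ i + 1 * (r * pi ^ i)" for n
      unfolding True by (intro tendsto_add tendsto_mult tendsto_const LIMSEQ_ignore_initial_segment r)
    then show ?thesis
      using r(1) True by (intro exI[of _ "2 * r"]) (auto simp: algebra_simps)
  next
    case False
    then have m1: "s * (-1) ^ i = -1"
      using s by (auto simp: minus_one_power_iff split: if_splits)
    have "(\<lambda>M. odd_psum s i (M + 2 * n) + s * (-1) ^ i * odd_psum s i (M + 1)) \<longlonglongrightarrow> 0" for n
      unfolding m1
      using tendsto_diff[OF odd_psum_shift_diff[OF s \<open>i \<ge> 1\<close>, of "2 * n"]
          odd_psum_shift_diff[OF s \<open>i \<ge> 1\<close>, of 1]] by (simp add: algebra_simps)
    then show ?thesis
      using False by (intro exI[of _ 0]) auto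
  qed
  then obtain r where r: "r \<in> \<rat>" "s * (-1) ^ i \<noteq> 1 \<Longrightarrow> r = 0" and
    rlim: "\<And>n. (\<lambda>M. odd_psum s i (M + 2 * n) + s * (-1) ^ i * odd_psum s i (M + 1)) \<longlonglongrightarrow> r * pi ^ i"
    by blast
  have "(\<lambda>M. \<Sum>m=1..M. s ^ m / (2 * real n - 1 - 2 * real m) ^ i + s ^ m / (2 * real n - 1 + 2 * real m) ^ i)
      \<longlonglongrightarrow> s ^ n * (r * pi ^ i) - 1 / (2 * real n - 1) ^ i" for n
  \<comment> \<open>Starting at \<open>M + n\<close> turns the lower end
    \<open>n - (M + n) - 1\<close> into \<open>- (M + 1)\<close>, where the reflection of
    \<open>odd_isum\<close> applies.\<close>
  proof (rule LIMSEQ_offset[where k = n])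
    have eq: "odd_isum s i (int n + int (M + n)) - odd_isum s i (int n - int (M + n) - 1)
        = odd_psum s i (M + 2 * n) + s * (-1) ^ i * odd_psum s i (M + 1)" for M
    proof -
      have "int n + int (M + n) = int (M + 2 * n)" "int n - int (M + n) - 1 = - int (M + 1)"
        by simp_all
      then show ?thesis
        by (simp only: odd_isum_minus[OF s] odd_isum_of_nat)
    qed
    show "(\<lambda>M. \<Sum>m=1..M + n. s ^ m / (2 * real n - 1 - 2 * real m) ^ i + s ^ m / (2 * real n - 1 + 2 * real m) ^ i)
      \<longlonglongrightarrow> s ^ n * (r * pi ^ i) - 1 / (2 * real n - 1) ^ i"
      unfolding two_sided_odd_sum[OF s] eq by (intro tendsto_intros rlim)
  qed
  with r show ?thesis
    by blast
qed

section \<open>Zeta and beta values as limits of sums over odd denominators\<close>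

lemma summable_inverse_powers:
  assumes "j \<ge> 2"
  shows "summable (\<lambda>k. 1 / (real k + 1) ^ j)"
  using Polygamma_converges'[of "1::real" j] assms by (simp add: inverse_eq_divide add_ac)

text \<open>The zeta series is split by the parity of the denominators; the even part is
  \<open>(1/2) ^ j\<close> times the whole. The alternating series is the even part minus the odd
  part, its first term being -1.\<close>

lemma zeta_value_even_odd:
  assumes "j \<ge> 2"
  shows "odd_psum 1 j \<longlonglongrightarrow> (1 - (1/2) ^ j) * zeta_value j"
    and "(\<lambda>k. (-1) ^ Suc k / (real k + 1) ^ j) sums ((2 * (1/2) ^ j - 1) * zeta_value j)"
proof -
  let ?z = "\<lambda>k. 1 / (real k + 1) ^ j"
  have z: "?z sums zeta_value j"
    unfolding zeta_value_def by (intro summable_sums summable_inverse_powers assms)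
  have half: "(1/2) ^ j * ?z k = 1 / (2 * real k + 2) ^ j" for k
  proof -
    have "2 * real k + 2 = 2 * (real k + 1)"
      by simp
    then show ?thesis
      by (simp only: power_mult_distrib power_one_over) simp
  qed
  have even: "(\<lambda>k. 1 / (2 * real k + 2) ^ j) sums ((1/2) ^ j * zeta_value j)"
    using sums_mult[OF z, of "(1/2) ^ j"] unfolding half .
  have ivl: "{k * 2..<k * 2 + 2} = {k * 2, k * 2 + 1}" for k :: nat
    by auto
  have "sum ?z {k * 2..<k * 2 + 2} = 1 / (2 * real k + 1) ^ j + 1 / (2 * real k + 2) ^ j" for k
    unfolding ivl by (simp add: ac_simps)
  with sums_group[OF z, of 2]
  have "(\<lambda>k. 1 / (2 * real k + 1) ^ j + 1 / (2 * real k + 2) ^ j) sums zeta_value j"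
    by simp
  from sums_diff[OF this even]
  have odd: "(\<lambda>k. 1 / (2 * real k + 1) ^ j) sums ((1 - (1/2) ^ j) * zeta_value j)"
    by (simp add: algebra_simps)
  then show "odd_psum 1 j \<longlonglongrightarrow> (1 - (1/2) ^ j) * zeta_value j"
    by (simp add: odd_psum_LIMSEQ_iff)
  let ?a = "\<lambda>k. (-1) ^ Suc k / (real k + 1) ^ j"
  have "summable ?a"
    by (rule summable_comparison_test'[OF summable_inverse_powers[OF assms], where N = 0])
      (auto simp: norm_divide norm_power power_abs)
  then obtain L where L: "?a sums L"
    by blast
  have "sum ?a {k * 2..<k * 2 + 2} = 1 / (2 * real k + 2) ^ j - 1 / (2 * real k + 1) ^ j" for k
    unfolding ivl by (simp add: ac_simps)
  with sums_group[OF L, of 2]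
  have "(\<lambda>k. 1 / (2 * real k + 2) ^ j - 1 / (2 * real k + 1) ^ j) sums L"
    by simp
  from sums_unique2[OF this sums_diff[OF even odd]] have "L = (2 * (1/2) ^ j - 1) * zeta_value j"
    by (simp add: algebra_simps)
  with L show "?a sums ((2 * (1/2) ^ j - 1) * zeta_value j)"
    by simp
qed

lemma odd_psum_alternating_limit:
  assumes "j \<ge> 2"
  shows "odd_psum (-1) j \<longlonglongrightarrow> - dirichlet_beta j"
proof -
  let ?b = "\<lambda>k. (-1) ^ k / (2 * real k + 1) ^ j"
  have "summable ?b"
    by (rule summable_comparison_test'[OF summable_inverse_powers[OF assms], where N = 0])
      (auto simp: norm_divide norm_power power_abs intro!: divide_left_mono power_mono)
  then have "?b sums dirichlet_beta j"
    unfolding dirichlet_beta_def by (rule summable_sums)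
  from sums_minus[OF this] show ?thesis
    by (simp add: odd_psum_LIMSEQ_iff)
qed

text \<open>For odd \<open>i\<close> the terms for \<open>m\<close> and \<open>- m\<close> cancel.
  For even \<open>i\<close> the zeta value is recovered from its odd part, already known as a
  rational multiple of \<open>pi ^ i\<close>.\<close>

lemma two_sided_even_sum_limit:
  assumes s: "s \<in> {1, -1}" and "i \<ge> 1"
  shows "\<exists>r. r \<in> \<rat> \<and> (odd i \<longrightarrow> r = 0) \<and>
    (\<lambda>M. \<Sum>m=1..M. s ^ m / (2 * real m) ^ i + s ^ m / (- 2 * real m) ^ i) \<longlonglongrightarrow> r * pi ^ i"
proof (cases "even i")
  case False
  then have "(- 2 * real m) ^ i = - ((2 * real m) ^ i)" for m
    by (simp add: power_minus_odd)
  then show ?thesis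
    using False by (intro exI[of _ 0]) simp
next
  case True
  with \<open>i \<ge> 1\<close> have "i \<ge> 2"
    by (cases "i = 1") auto
  obtain r where r: "r \<in> \<rat>" "odd_psum 1 i \<longlonglongrightarrow> r * pi ^ i"
    using odd_psum_even_power_limit[of i] True \<open>i \<ge> 1\<close> by auto
  have lt1: "(1/2::real) ^ i < 1"
    using \<open>i \<ge> 1\<close> by (simp add: power_less_one_iff)
  have zeta: "zeta_value i = r / (1 - (1/2) ^ i) * pi ^ i"
    using LIMSEQ_unique[OF r(2) zeta_value_even_odd(1)[OF \<open>i \<ge> 2\<close>]] lt1 by (simp add: field_simps)
  \<comment> \<open>The ratio of the series with signs \<open>s ^ m\<close> to
    \<open>zeta_value i\<close>.\<close>
  define t :: real where "t = (if s = 1 then 1 else 2 * (1/2) ^ i - 1)"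
  have "(\<lambda>k. s ^ Suc k / (real k + 1) ^ i) sums (t * zeta_value i)"
    using s zeta_value_even_odd(2)[OF \<open>i \<ge> 2\<close>] summable_inverse_powers[OF \<open>i \<ge> 2\<close>, THEN summable_sums]
    by (auto simp: t_def zeta_value_def)
  from sums_mult[OF this, of "2 * (1/2) ^ i"]
  have "(\<lambda>k. 2 * (1/2) ^ i * (s ^ Suc k / (real k + 1) ^ i)) sums
      (2 * (1/2) ^ i * t * (r / (1 - (1/2) ^ i)) * pi ^ i)"
    by (simp only: zeta mult.assoc)
  moreover have "(\<Sum>m=1..M. s ^ m / (2 * real m) ^ i + s ^ m / (- 2 * real m) ^ i)
      = (\<Sum>k<M. 2 * (1/2) ^ i * (s ^ Suc k / (real k + 1) ^ i))" for M
  proof -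
    have "(- 2 * real m) ^ i = (2 * real m) ^ i" for m
      using True by simp
    then have "s ^ m / (2 * real m) ^ i + s ^ m / (- 2 * real m) ^ i = 2 * (1/2) ^ i * (s ^ m / real m ^ i)" for m
      by (simp add: power_mult_distrib power_one_over)
    then show ?thesis
      by (induction M) (simp_all add: add_ac)
  qed
  ultimately have "(\<lambda>M. \<Sum>m=1..M. s ^ m / (2 * real m) ^ i + s ^ m / (- 2 * real m) ^ i)
      \<longlonglongrightarrow> 2 * (1/2) ^ i * t * (r / (1 - (1/2) ^ i)) * pi ^ i"
    by (simp add: sums_def)
  moreover have "2 * (1/2) ^ i * t * (r / (1 - (1/2) ^ i)) \<in> \<rat>"
    using r(1) by (simp add: t_def Rats_divide)
  ultimately show ?thesis
    using True by blast
qed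

text \<open>
  The two-sided sum over even \<open>m\<close> is split into one-variable sums by partial fractions in \<open>m\<close>
  and \<open>k - m\<close>, where \<open>k = 2 * n - 1\<close> is odd.
\<close>

lemma column_sum_limit:
  assumes s: "s \<in> {1, -1}" and "p \<ge> 1" "q \<ge> 1" "n \<ge> 1"
    and pf: "\<And>x y :: real. x \<noteq> 0 \<Longrightarrow> y \<noteq> 0 \<Longrightarrow> x + y \<noteq> 0 \<Longrightarrow> 1 / (x ^ p * y ^ q) =
        (\<Sum>i=1..p. c i / (x ^ i * (x + y) ^ (p + q - i))) +
        (\<Sum>i=1..q. d i / (y ^ i * (x + y) ^ (p + q - i)))"
    and U: "\<And>i. i \<ge> 1 \<Longrightarrow>
      (\<lambda>M. \<Sum>m=1..M. s ^ m / (2 * real m) ^ i + s ^ m / (- 2 * real m) ^ i) \<longlonglongrightarrow> U i"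
    and W: "\<And>i n. i \<ge> 1 \<Longrightarrow>
      (\<lambda>M. \<Sum>m=1..M. s ^ m / (2 * real n - 1 - 2 * real m) ^ i + s ^ m / (2 * real n - 1 + 2 * real m) ^ i)
      \<longlonglongrightarrow> s ^ n * W i - 1 / (2 * real n - 1) ^ i"
  shows "(\<lambda>M. \<Sum>m=1..M. s ^ m / ((2 * real m) ^ p * (2 * real n - 1 - 2 * real m) ^ q) +
                        s ^ m / ((- 2 * real m) ^ p * (2 * real n - 1 + 2 * real m) ^ q)) \<longlonglongrightarrow>
    (\<Sum>i=1..p. c i * U i / (2 * real n - 1) ^ (p + q - i)) +
    (\<Sum>i=1..q. d i * (s ^ n * W i / (2 * real n - 1) ^ (p + q - i) - 1 / (2 * real n - 1) ^ (p + q)))"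
proof -
  let ?k = "2 * real n - 1"
  let ?u = "\<lambda>i m. s ^ m / (2 * real m) ^ i + s ^ m / (- 2 * real m) ^ i"
  let ?w = "\<lambda>i m. s ^ m / (?k - 2 * real m) ^ i + s ^ m / (?k + 2 * real m) ^ i"
  have odd_nz: "2 * real n - 1 - 2 * of_int m \<noteq> 0" for m :: int
  proof
    assume "2 * real n - 1 - 2 * of_int m = 0"
    then have "real_of_int (2 * int n - 1 - 2 * m) = of_int 0"
      by simp
    then have "2 * int n - 1 - 2 * m = 0"
      unfolding of_int_eq_iff .
    then show False
      by presburger
  qed
  have k: "?k \<noteq> 0"
    using odd_nz[of 0] by simp
  have split: "s ^ m / ((2 * real m) ^ p * (?k - 2 * real m) ^ q) +
        s ^ m / ((- 2 * real m) ^ p * (?k + 2 * real m) ^ q)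
      = (\<Sum>i=1..p. c i / ?k ^ (p + q - i) * ?u i m) + (\<Sum>i=1..q. d i / ?k ^ (p + q - i) * ?w i m)"
    if "m \<ge> 1" for m
  proof -
    have nz: "?k - 2 * real m \<noteq> 0" "?k + 2 * real m \<noteq> 0"
      using odd_nz[of "int m"] odd_nz[of "- int m"] by simp_all
    have "1 / ((2 * real m) ^ p * (?k - 2 * real m) ^ q) =
        (\<Sum>i=1..p. c i / ((2 * real m) ^ i * ?k ^ (p + q - i))) +
        (\<Sum>i=1..q. d i / ((?k - 2 * real m) ^ i * ?k ^ (p + q - i)))"
      using pf[of "2 * real m" "?k - 2 * real m"] that nz k by simp
    moreover have "1 / ((- 2 * real m) ^ p * (?k + 2 * real m) ^ q) =
        (\<Sum>i=1..p. c i / ((- 2 * real m) ^ i * ?k ^ (p + q - i))) +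
        (\<Sum>i=1..q. d i / ((?k + 2 * real m) ^ i * ?k ^ (p + q - i)))"
      using pf[of "- 2 * real m" "?k + 2 * real m"] that nz k by simp
    ultimately have "s ^ m * (1 / ((2 * real m) ^ p * (?k - 2 * real m) ^ q)) +
        s ^ m * (1 / ((- 2 * real m) ^ p * (?k + 2 * real m) ^ q)) =
        (\<Sum>i=1..p. s ^ m * (c i / ((2 * real m) ^ i * ?k ^ (p + q - i))) +
          s ^ m * (c i / ((- 2 * real m) ^ i * ?k ^ (p + q - i)))) +
        (\<Sum>i=1..q. s ^ m * (d i / ((?k - 2 * real m) ^ i * ?k ^ (p + q - i))) +
          s ^ m * (d i / ((?k + 2 * real m) ^ i * ?k ^ (p + q - i))))"
      by (simp only: sum.distrib sum_distrib_left ring_distribs add_ac)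
    also have "\<dots> = (\<Sum>i=1..p. c i / ?k ^ (p + q - i) * ?u i m) + (\<Sum>i=1..q. d i / ?k ^ (p + q - i) * ?w i m)"
      by (intro arg_cong2[where f = "(+)"] sum.cong refl) (simp_all only: ring_distribs times_divide_times_eq times_divide_eq_right times_divide_eq_left divide_divide_eq_left mult_1_left mult_ac)
    finally show ?thesis
      by simp
  qed
  have "(\<Sum>m=1..M. s ^ m / ((2 * real m) ^ p * (?k - 2 * real m) ^ q) +
                    s ^ m / ((- 2 * real m) ^ p * (?k + 2 * real m) ^ q))
      = (\<Sum>i=1..p. c i / ?k ^ (p + q - i) * (\<Sum>m=1..M. ?u i m)) +
        (\<Sum>i=1..q. d i / ?k ^ (p + q - i) * (\<Sum>m=1..M. ?w i m))" for M
  proof -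
    have "(\<Sum>m=1..M. s ^ m / ((2 * real m) ^ p * (?k - 2 * real m) ^ q) +
                    s ^ m / ((- 2 * real m) ^ p * (?k + 2 * real m) ^ q))
      = (\<Sum>m=1..M. (\<Sum>i=1..p. c i / ?k ^ (p + q - i) * ?u i m) + (\<Sum>i=1..q. d i / ?k ^ (p + q - i) * ?w i m))"
      by (intro sum.cong refl split) auto
    also have "\<dots> = (\<Sum>i=1..p. c i / ?k ^ (p + q - i) * (\<Sum>m=1..M. ?u i m)) +
        (\<Sum>i=1..q. d i / ?k ^ (p + q - i) * (\<Sum>m=1..M. ?w i m))"
      unfolding sum.distrib[of "\<lambda>m. \<Sum>i=1..p. _ i m"] sum_distrib_left
      by (intro arg_cong2[where f = "(+)"] sum.swap)
    finally show ?thesis .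
  qed
  moreover have "(\<lambda>M. (\<Sum>i=1..p. c i / ?k ^ (p + q - i) * (\<Sum>m=1..M. ?u i m)) +
        (\<Sum>i=1..q. d i / ?k ^ (p + q - i) * (\<Sum>m=1..M. ?w i m))) \<longlonglongrightarrow>
      (\<Sum>i=1..p. c i / ?k ^ (p + q - i) * U i) +
      (\<Sum>i=1..q. d i / ?k ^ (p + q - i) * (s ^ n * W i - 1 / ?k ^ i))"
    by (intro tendsto_intros U W) auto
  \<comment> \<open>The missing term \<open>1 / k ^ i\<close> at \<open>m = 0\<close> completes the
    power to \<open>k ^ (p + q)\<close>, whatever \<open>i\<close> is.\<close>
  moreover have "d i / ?k ^ (p + q - i) * (s ^ n * W i - 1 / ?k ^ i)
      = d i * (s ^ n * W i / ?k ^ (p + q - i) - 1 / ?k ^ (p + q))" if "i \<in> {1..q}" for i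
  proof -
    have "?k ^ (p + q) = ?k ^ (p + q - i) * ?k ^ i"
      using that by (subst power_add[symmetric]) auto
    then show ?thesis
      by (simp add: right_diff_distrib)
  qed
  ultimately show ?thesis
    by (simp only: times_divide_eq_left cong: sum.cong)
qed

subsection \<open>The error term of the summation by rows\<close>

text \<open>A crude substitute for logarithmic growth: \<open>sqrt m / m ^ 2\<close> is still
  summable and \<open>sqrt N / N\<close> still tends to 0, as the error estimates require. By the
  inequality of arithmetic and geometric means, 1/sqrt(n+1) is at most 2(sqrt(n+1) - sqrt
  n).\<close>

lemma harm_le_sqrt: "harm n \<le> (2 * sqrt n :: real)"
proof (induction n)
  case 0
  then show ?case by (simp add: harm_def)
next
  case (Suc n)
  have "sqrt (Suc n) * sqrt n \<le> (real (Suc n) + real n) / 2"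
    using arith_geo_mean_sqrt[of "Suc n" n] by (simp add: real_sqrt_mult)
  then have "1 \<le> 2 * (sqrt (Suc n) - sqrt n) * sqrt (Suc n)"
    by (simp add: algebra_simps)
  then have "1 / sqrt (Suc n) \<le> 2 * (sqrt (Suc n) - sqrt n)"
    by (subst pos_divide_le_eq) auto
  moreover have "inverse (real (Suc n)) \<le> 1 / sqrt (Suc n)"
  proof -
    have "sqrt (Suc n) \<le> real (Suc n)"
      by (intro real_le_lsqrt) (auto simp: power2_eq_square)
    then show ?thesis
      by (simp add: inverse_eq_divide frac_le del: of_nat_Suc)
  qed
  ultimately show ?case
    using Suc by (simp add: harm_Suc)
qed

text \<open>The k-th term after position \<open>n\<close> is at most 1/k, whatever \<open>n\<close>
  is. This uniformity later yields a majorant free of \<open>N\<close>.\<close>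

lemma odd_psum_diff_le_harm:
  assumes s: "s \<in> {1, -1}" and "q \<ge> 1"
  shows "\<bar>odd_psum s q (n + m) - odd_psum s q n\<bar> \<le> harm m"
proof (induction m)
  case 0
  then show ?case by (simp add: harm_def)
next
  case (Suc m)
  have "\<bar>s ^ Suc (n + m) / (2 * real (n + m) + 1) ^ q\<bar> \<le> inverse (real (Suc m))"
  proof -
    have "real (Suc m) \<le> 2 * real (n + m) + 1"
      by simp
    also have "\<dots> \<le> (2 * real (n + m) + 1) ^ q"
      using \<open>q \<ge> 1\<close> by (intro self_le_power) auto
    finally have "1 / (2 * real (n + m) + 1) ^ q \<le> 1 / real (Suc m)"
      by (intro divide_left_mono) auto
    moreover have "\<bar>s\<bar> = 1"
      using s by auto
    ultimately show ?thesis
      by (simp add: abs_mult power_abs inverse_eq_divide)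
  qed
  moreover have "odd_psum s q (n + Suc m) - odd_psum s q n
      = (odd_psum s q (n + m) - odd_psum s q n) + s ^ Suc (n + m) / (2 * real (n + m) + 1) ^ q"
    by simp
  ultimately have "\<bar>odd_psum s q (n + Suc m) - odd_psum s q n\<bar> \<le> harm m + inverse (real (Suc m))"
    using Suc by linarith
  then show ?case
    by (simp add: harm_Suc)
qed

text \<open>For \<open>m > N\<close> the way from \<open>N\<close> down to \<open>N - m\<close>
  crosses 0; the two pieces are bounded separately, whence the factor 2.\<close>

lemma odd_isum_diff_le_harm:
  assumes s: "s \<in> {1, -1}" and "q \<ge> 1"
  shows "\<bar>odd_isum s q (int N - int m) - odd_psum s q N\<bar> \<le> 2 * harm m"
proof (cases "m \<le> N")
  case True
  then have "int N - int m = int (N - m)"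
    by simp
  then have "odd_isum s q (int N - int m) = odd_psum s q (N - m)"
    by (simp only: odd_isum_of_nat)
  then have "\<bar>odd_isum s q (int N - int m) - odd_psum s q N\<bar> \<le> harm m"
    using odd_psum_diff_le_harm[OF assms, of "N - m" m] True by (simp add: abs_minus_commute)
  also have "\<dots> \<le> 2 * harm m"
    using harm_nonneg[of m, where 'a = real] by linarith
  finally show ?thesis .
next
  case False
  then have eq: "int N - int m = - int (m - N)"
    by simp
  have "\<bar>odd_psum s q (m - N)\<bar> \<le> harm (m - N)" "\<bar>odd_psum s q N\<bar> \<le> harm N"
    using odd_psum_diff_le_harm[OF assms, of 0] by simp_all
  moreover have "harm (m - N) \<le> (harm m :: real)" "harm N \<le> (harm m :: real)"
    using False by (auto intro!: harm_mono)
  moreover have "\<bar>odd_isum s q (int N - int m)\<bar> = \<bar>odd_psum s q (m - N)\<bar>"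
    unfolding eq odd_isum_minus[OF s] odd_isum_of_nat using s by (auto simp: abs_mult power_abs)
  ultimately show ?thesis
    by linarith
qed

text \<open>The error made in the rows \<open>m\<close> and \<open>- m\<close> together when
  \<open>h (N - m)\<close> and \<open>h (N + m)\<close> are replaced by \<open>h N\<close>; the sign
  \<open>(-1) ^ p\<close> stems from \<open>(- 2 * m) ^ p\<close>.\<close>

definition row_error :: "real \<Rightarrow> real \<Rightarrow> nat \<Rightarrow> nat \<Rightarrow> nat \<Rightarrow> nat \<Rightarrow> real" where
  "row_error s1 s2 p q N m = s1 ^ m / (2 * real m) ^ p *
     (odd_isum s2 q (int N - int m) + (-1) ^ p * odd_psum s2 q (N + m) - (1 + (-1) ^ p) * odd_psum s2 q N)"

lemma row_error_tendsto_0: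
  assumes "s2 \<in> {1, -1}" and "q \<ge> 1"
  shows "(\<lambda>N. row_error s1 s2 p q N m) \<longlonglongrightarrow> 0"
\<comment> \<open>Shifting \<open>N\<close> by \<open>m\<close> keeps the argument
  \<open>N - m\<close> of \<open>odd_isum\<close> nonnegative.\<close>
proof (rule LIMSEQ_offset[where k = m])
  have "(\<lambda>N. odd_psum s2 q (N + m) - odd_psum s2 q N) \<longlonglongrightarrow> 0"
    by (rule odd_psum_shift_diff[OF assms])
  moreover from this have "(\<lambda>N. odd_psum s2 q (N + m + m) - odd_psum s2 q (N + m)) \<longlonglongrightarrow> 0"
    by (rule LIMSEQ_ignore_initial_segment)
  ultimately have "(\<lambda>N. s1 ^ m / (2 * real m) ^ p *
      (- (odd_psum s2 q (N + m) - odd_psum s2 q N) +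
       (-1) ^ p * (odd_psum s2 q (N + m + m) - odd_psum s2 q (N + m))))
    \<longlonglongrightarrow> s1 ^ m / (2 * real m) ^ p * (- 0 + (-1) ^ p * 0)"
    by (intro tendsto_intros)
  then show "(\<lambda>N. row_error s1 s2 p q (N + m) m) \<longlonglongrightarrow> 0"
    by (simp add: row_error_def algebra_simps)
qed

text \<open>Dominated convergence in the form of Tannery's theorem. The bracket grows at most like
  \<open>sqrt m\<close>, so for exponents \<open>p\<close> from 2 on the errors are bounded by a
  multiple of m^(-3/2), uniformly in \<open>N\<close>.\<close>

lemma row_error_sum_tendsto_0_absolute:
  assumes s: "s1 \<in> {1, -1}" "s2 \<in> {1, -1}" and q: "q \<ge> 1" and p: "p \<ge> 2"
  shows "summable (\<lambda>k. row_error s1 s2 p q N (Suc k))"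
    and "(\<lambda>N. suminf (\<lambda>k. row_error s1 s2 p q N (Suc k))) \<longlonglongrightarrow> 0"
proof -
  let ?M = "\<lambda>k. 2 * real (Suc k) powr (- 3 / 2)"
  have bound: "norm (row_error s1 s2 p q N m) \<le> 2 * real m powr (- 3 / 2)" if "m > 0" for N m
  proof -
    have "odd_isum s2 q (int N - int m) + (-1) ^ p * odd_psum s2 q (N + m) - (1 + (-1) ^ p) * odd_psum s2 q N
      = (odd_isum s2 q (int N - int m) - odd_psum s2 q N) + (-1) ^ p * (odd_psum s2 q (N + m) - odd_psum s2 q N)"
      by (simp add: algebra_simps)
    also have "\<bar>\<dots>\<bar> \<le> \<bar>odd_isum s2 q (int N - int m) - odd_psum s2 q N\<bar> + \<bar>odd_psum s2 q (N + m) - odd_psum s2 q N\<bar>"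
      by (rule order.trans[OF abs_triangle_ineq]) (simp add: abs_mult power_abs)
    also have "\<dots> \<le> 3 * harm m"
      using odd_isum_diff_le_harm[OF s(2) q, of N m] odd_psum_diff_le_harm[OF s(2) q, of N m] by linarith
    also have "\<dots> \<le> 6 * sqrt m"
      using harm_le_sqrt[of m] by simp
    finally have 1: "\<bar>odd_isum s2 q (int N - int m) + (-1) ^ p * odd_psum s2 q (N + m)
        - (1 + (-1) ^ p) * odd_psum s2 q N\<bar> \<le> 6 * sqrt m" .
    have "(2 * real m) ^ 2 \<le> (2 * real m) ^ p"
      using that p by (intro power_increasing) auto
    then have "1 / (2 * real m) ^ p \<le> 1 / (2 * real m) ^ 2"
      using that by (intro divide_left_mono) auto
    moreover have "\<bar>s1\<bar> = 1"
      using s by auto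
    ultimately have 2: "\<bar>s1 ^ m / (2 * real m) ^ p\<bar> \<le> 1 / (4 * real m ^ 2)"
      by (simp add: power_abs power_mult_distrib)
    have "norm (row_error s1 s2 p q N m) \<le> 1 / (4 * real m ^ 2) * (6 * sqrt m)"
      unfolding row_error_def real_norm_def abs_mult by (intro mult_mono 1 2) auto
    also have "\<dots> = 3 / 2 * real m powr (- 3 / 2)"
    proof -
      have "sqrt m / real m ^ 2 = real m powr (1 / 2) / real m powr 2"
        using that by (simp add: powr_half_sqrt)
      also have "\<dots> = real m powr (- 3 / 2)"
        unfolding powr_diff[symmetric] by simp
      finally show ?thesis
        by simp
    qed
    also have "\<dots> \<le> 2 * real m powr (- 3 / 2)"
      by (intro mult_right_mono) auto
    finally show ?thesis .
  qed
  have M: "summable ?M"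
    by (subst summable_Suc_iff[of "\<lambda>k. 2 * real k powr (- 3 / 2)"])
      (intro summable_mult, simp add: summable_real_powr_iff)
  show "summable (\<lambda>k. row_error s1 s2 p q N (Suc k))"
    by (rule summable_comparison_test'[OF M, where N = 0]) (rule bound, simp)
  have "eventually (\<lambda>(k, N). norm (row_error s1 s2 p q N (Suc k)) \<le> ?M k) (at_top \<times>\<^sub>F sequentially)"
    by (intro always_eventually allI, clarify, rule bound) simp
  from tannerys_theorem[OF row_error_tendsto_0[OF s(2) q] this M]
  show "(\<lambda>N. suminf (\<lambda>k. row_error s1 s2 p q N (Suc k))) \<longlonglongrightarrow> 0"
    by simp
qed

section \<open>Tails of the inner series, for the case \<open>p = 1\<close>\<close>

lemma odd_psum_alternating_diff:
  fixes q n :: nat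
  defines "D \<equiv> \<lambda>n m. (-1) ^ Suc n * (odd_psum (-1) q (n + m) - odd_psum (-1) q n)"
  shows "0 \<le> D n m \<and> D n m \<le> 1 / (2 * real n + 1) ^ q"
proof (induction m arbitrary: n)
  case 0
  then show ?case by (simp add: D_def)
next
  case (Suc m)
  \<comment> \<open>Removing the first term leaves the same kind of sum with opposite sign, as in
    the Leibniz criterion.\<close>
  have "D n (Suc m) = 1 / (2 * real n + 1) ^ q - D (Suc n) m"
    by (simp add: D_def algebra_simps flip: power_add mult_2)
  moreover have "1 / (2 * real (Suc n) + 1) ^ q \<le> 1 / (2 * real n + 1) ^ q"
    by (intro divide_left_mono power_mono) auto
  ultimately show ?case
    using Suc[of "Suc n"] by linarith
qed

text \<open>Comparison with the telescoping terms 2/(x+1) - 2/(x+2). Keeping the subtracted end term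
  makes the bound inductive.\<close>

lemma odd_psum_telescoping_bound:
  assumes "q \<ge> 2"
  shows "0 \<le> odd_psum 1 q (n + m) - odd_psum 1 q n \<and>
    odd_psum 1 q (n + m) - odd_psum 1 q n \<le> 2 / (real n + 1) - 2 / (real n + real m + 1)"
proof (induction m)
  case 0
  then show ?case by simp
next
  case (Suc m)
  let ?x = "real n + real m"
  have "1 / (2 * ?x + 1) ^ q \<le> 1 / (2 * ?x + 1) ^ 2"
    using assms by (intro divide_left_mono power_increasing) auto
  also have "\<dots> \<le> 2 / ((?x + 1) * (?x + 2))"
  proof -
    have "(?x + 1) * (?x + 2) \<le> 2 * (2 * ?x + 1) ^ 2"
      using mult_nonneg_nonneg[of ?x ?x] by (simp add: power2_eq_square algebra_simps)
    then show ?thesis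
      by (simp add: divide_simps add_pos_pos add_nonneg_eq_0_iff)
  qed
  also have "\<dots> = 2 / (?x + 1) - 2 / (?x + 2)"
    by (simp add: divide_simps)
  finally have "1 / (2 * ?x + 1) ^ q \<le> 2 / (?x + 1) - 2 / (?x + 2)" .
  moreover have "0 \<le> 1 / (2 * ?x + 1) ^ q"
    by simp
  moreover have "odd_psum 1 q (n + Suc m) = odd_psum 1 q (n + m) + 1 / (2 * ?x + 1) ^ q"
    by (simp add: algebra_simps)
  moreover have "real n + real (Suc m) + 1 = ?x + 2"
    by simp
  ultimately show ?case
    using Suc by (simp only:) linarith
qed

text \<open>The divergent case \<open>s = 1\<close>, \<open>q = 1\<close> is excluded. The
  differences are bounded uniformly in the second index, which gives the Cauchy property and, as
  that index tends to infinity, the distance from the limit.\<close>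

lemma odd_psum_tail:
  assumes s: "s \<in> {1, -1}" and "q \<ge> 1" and "s = -1 \<or> q \<ge> 2"
  obtains L where "\<And>n. \<bar>odd_psum s q n - L\<bar> \<le> 2 / (real n + 1)"
proof -
  have diff: "\<bar>odd_psum s q (n + m) - odd_psum s q n\<bar> \<le> 2 / (real n + 1)" for n m
  proof (cases "s = -1")
    case True
    have "\<bar>odd_psum s q (n + m) - odd_psum s q n\<bar>
        = \<bar>(-1) ^ Suc n * (odd_psum (-1) q (n + m) - odd_psum (-1) q n)\<bar>"
      by (simp add: True abs_mult power_abs)
    also have "\<dots> \<le> 1 / (2 * real n + 1) ^ q"
      using odd_psum_alternating_diff[of n q m] by simp
    also have "\<dots> \<le> 1 / (2 * real n + 1)"
      using self_le_power[of "2 * real n + 1" q] \<open>q \<ge> 1\<close> by (intro divide_left_mono) auto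
    also have "\<dots> \<le> 2 / (real n + 1)"
      by (simp add: divide_simps)
    finally show ?thesis .
  next
    case False
    then have "s = 1" "q \<ge> 2"
      using assms by auto
    have "0 \<le> 2 / (real n + real m + 1)"
      by simp
    then show ?thesis
      unfolding \<open>s = 1\<close> using odd_psum_telescoping_bound[OF \<open>q \<ge> 2\<close>, of n m] by linarith
  qed
  have lim0: "(\<lambda>n. 2 / (real n + 1)) \<longlonglongrightarrow> 0"
    using LIMSEQ_Suc[OF lim_const_over_n[of "2::real"]] by (simp add: add.commute)
  have "Cauchy (odd_psum s q)"
  proof (rule metric_CauchyI)
    fix e :: real
    assume "e > 0"
    then have "eventually (\<lambda>n. 2 / (real n + 1) < e / 2) sequentially"
      by (intro order_tendstoD(2)[OF lim0]) simp
    then obtain n where n: "2 / (real n + 1) < e / 2"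
      by (auto simp: eventually_sequentially)
    have close: "\<bar>odd_psum s q m - odd_psum s q n\<bar> < e / 2" if "m \<ge> n" for m
      using diff[of n "m - n"] n that by simp
    have "dist (odd_psum s q m) (odd_psum s q l) < e" if "m \<ge> n" "l \<ge> n" for m l
      using close[OF that(1)] close[OF that(2)] unfolding dist_real_def by linarith
    then show "\<exists>M. \<forall>m\<ge>M. \<forall>n\<ge>M. dist (odd_psum s q m) (odd_psum s q n) < e"
      by blast
  qed
  then obtain L where L: "odd_psum s q \<longlonglongrightarrow> L"
    using Cauchy_convergent_iff convergent_def by blast
  have "\<bar>odd_psum s q n - L\<bar> \<le> 2 / (real n + 1)" for n
  proof -
    have "(\<lambda>m. \<bar>odd_psum s q (m + n) - odd_psum s q n\<bar>) \<longlonglongrightarrow> \<bar>L - odd_psum s q n\<bar>"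
      by (intro tendsto_intros LIMSEQ_ignore_initial_segment L)
    then have "\<bar>L - odd_psum s q n\<bar> \<le> 2 / (real n + 1)"
      by (rule Lim_bounded[where M = 0]) (use diff[of n] in \<open>auto simp: add.commute\<close>)
    then show ?thesis
      by (simp add: abs_minus_commute)
  qed
  then show ?thesis
    by (rule that)
qed

text \<open>
  For \<open>p = 1\<close> there is no summable majorant.  The inner sums behave like \<open>L * sgn (N - m)\<close> up to
  \<open>O(1 / (\<bar>N - m\<bar> + 1))\<close>, so the error splits into a convolution of harmonic type for \<open>m \<le> N\<close>,
  a dominated part for \<open>m > N\<close>, and a multiple of the tail of the alternating harmonic series.
\<close>

lemma row_error_sum_tendsto_0_alternating:
  assumes s: "s2 \<in> {1, -1}" and q: "q \<ge> 1" and parity: "s2 * (-1) ^ q = 1"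
  shows "summable (\<lambda>k. row_error (-1) s2 1 q N (Suc k))"
    and "(\<lambda>N. suminf (\<lambda>k. row_error (-1) s2 1 q N (Suc k))) \<longlonglongrightarrow> 0"
proof -
  \<comment> \<open>For \<open>q = 1\<close> the parity forces \<open>s2 = -1\<close>, so the inner
    series converges.\<close>
  have "s2 = -1 \<or> q \<ge> 2"
    using s q parity by (cases "q = 1") auto
  then obtain L where L: "\<And>n. \<bar>odd_psum s2 q n - L\<bar> \<le> 2 / (real n + 1)"
    using odd_psum_tail[OF s q] by blast
  let ?f = "\<lambda>N k. row_error (-1) s2 1 q N (Suc k)"
  define a where "a k = (-1) ^ Suc k / real (Suc k)" for k
  \<comment> \<open>For \<open>m = j + N + 1\<close> the inner sums at \<open>N - m\<close> and
    \<open>N + m\<close> are close to \<open>- L\<close> and \<open>L\<close>. Splitting off this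
    constant leaves \<open>g\<close>, which is small, and \<open>L\<close> times a tail of the
    alternating harmonic series.\<close>
  define g where "g N j = a (j + N) / 2 * (2 * L - odd_psum s2 q (Suc j) - odd_psum s2 q (N + Suc (j + N)))" for N j
  have f_eq: "row_error (-1) s2 1 q N m
      = (-1) ^ m / (2 * real m) * (odd_isum s2 q (int N - int m) - odd_psum s2 q (N + m))" for N m
    by (simp add: row_error_def)
  have tail_eq: "?f N (j + N) = g N j - L * a (j + N)" for N j
  proof -
    have eq: "int N - int (Suc (j + N)) = - int (Suc j)"
      by simp
    have "odd_isum s2 q (int N - int (Suc (j + N))) = - odd_psum s2 q (Suc j)"
      unfolding eq odd_isum_minus[OF s] odd_isum_of_nat using parity by (simp add: mult.assoc)
    then have "?f N (j + N) = a (j + N) / 2 * (- odd_psum s2 q (Suc j) - odd_psum s2 q (N + Suc (j + N)))"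
      unfolding f_eq by (simp add: a_def)
    then show ?thesis
      by (simp add: g_def algebra_simps)
  qed
  have g_bound: "norm (g N j) \<le> 2 / (real j + 1) * (1 / real (Suc (j + N)))" for N j
  proof -
    have "2 / (real (Suc j) + 1) \<le> 2 / (real j + 1)" "2 / (real (N + Suc (j + N)) + 1) \<le> 2 / (real j + 1)"
      by (intro divide_left_mono; simp)+
    then have "\<bar>2 * L - odd_psum s2 q (Suc j) - odd_psum s2 q (N + Suc (j + N))\<bar> \<le> 4 / (real j + 1)"
      using L[of "Suc j"] L[of "N + Suc (j + N)"] by linarith
    moreover have "\<bar>a (j + N)\<bar> = 1 / real (Suc (j + N))"
      by (simp add: a_def abs_mult power_abs)
    ultimately have "norm (g N j) \<le> 1 / real (Suc (j + N)) / 2 * (4 / (real j + 1))"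
      unfolding g_def real_norm_def abs_mult by (intro mult_mono) (auto simp del: odd_psum_Suc)
    also have "\<dots> = 2 / (real j + 1) * (1 / real (Suc (j + N)))"
    proof -
      have "1 / x / 2 * (4 / y) = 2 / y * (1 / x)" for x y :: real
        by (cases "x = 0"; cases "y = 0") (simp_all add: field_simps)
      then show ?thesis .
    qed
    finally show ?thesis .
  qed
  have a_sum: "summable a"
    using sums_minus[OF alternating_harmonic_series_sums] by (auto simp: a_def[abs_def] sums_iff)
  define M where "M j = 2 / (real j + 1) ^ 2" for j
  have M: "summable M"
    using summable_mult[OF summable_inverse_powers[of 2], of 2] by (simp add: M_def[abs_def])
  have g_M: "norm (g N j) \<le> M j" for N j
  proof -
    have "1 / real (Suc (j + N)) \<le> 1 / (real j + 1)"
      by (intro divide_left_mono) auto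
    then have "2 / (real j + 1) * (1 / real (Suc (j + N))) \<le> 2 / (real j + 1) * (1 / (real j + 1))"
      by (intro mult_left_mono) auto
    then show ?thesis
      using g_bound[of N j] by (simp add: M_def power2_eq_square)
  qed
  have g_sum: "summable (g N)" for N
    by (rule summable_comparison_test'[OF M, where N = 0]) (rule g_M)
  have a_tail: "summable (\<lambda>j. a (j + N))" for N
    using a_sum by (simp add: summable_iff_shift)
  have f_tail: "summable (\<lambda>j. ?f N (j + N))" for N
    unfolding tail_eq by (intro summable_diff summable_mult g_sum a_tail)
  then show f_sum: "summable (?f N)" for N
    by (subst (asm) summable_iff_shift)
  have f_suminf: "suminf (?f N) = (\<Sum>k<N. ?f N k) + (suminf (g N) - L * suminf (\<lambda>j. a (j + N)))" for N
    using suminf_split_initial_segment[OF f_sum, of N N]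
    unfolding tail_eq suminf_diff[OF g_sum summable_mult[OF a_tail], symmetric] suminf_mult[OF a_tail]
    by simp
  have "(\<lambda>N. \<Sum>k<N. ?f N k) \<longlonglongrightarrow> 0"
  proof (rule Lim_null_comparison)
    have "norm (\<Sum>k<N. ?f N k) \<le> 8 / sqrt (real (Suc N))" for N
    proof -
      \<comment> \<open>For \<open>m = k + 1\<close> up to \<open>N\<close> both inner sums lie
        within \<open>2 / (N - k)\<close> of \<open>L\<close>. The product of
        \<open>1 / (k + 1)\<close> and \<open>1 / (N - k)\<close> splits by partial fractions, as
        the denominators add up to \<open>N + 1\<close>.\<close>
      have "\<bar>?f N k\<bar> \<le> 2 / real (Suc N) * (inverse (real (Suc k)) + inverse (real (N - k)))" if "k < N" for k
      proof -
        have "int N - int (Suc k) = int (N - Suc k)"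
          using that by simp
        then have isum: "odd_isum s2 q (int N - int (Suc k)) = odd_psum s2 q (N - Suc k)"
          by (simp only: odd_isum_of_nat)
        have triangle: "\<bar>x - y\<bar> \<le> 2 * c" if "\<bar>x - L\<bar> \<le> c" "\<bar>y - L\<bar> \<le> c" for x y c
          using that by linarith
        have "2 / (real (N - Suc k) + 1) = 2 / real (N - k)"
          using that by (simp add: of_nat_diff)
        then have "\<bar>odd_psum s2 q (N - Suc k) - L\<bar> \<le> 2 / real (N - k)"
          using L[of "N - Suc k"] by simp
        moreover have "2 / (real (N + Suc k) + 1) \<le> 2 / real (N - k)"
          using that by (intro divide_left_mono) auto
        then have "\<bar>odd_psum s2 q (N + Suc k) - L\<bar> \<le> 2 / real (N - k)"
          using L[of "N + Suc k"] by (rule order.trans[rotated])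
        ultimately have "\<bar>odd_psum s2 q (N - Suc k) - odd_psum s2 q (N + Suc k)\<bar> \<le> 2 * (2 / real (N - k))"
          by (rule triangle)
        then have "\<bar>?f N k\<bar> \<le> 1 / (2 * real (Suc k)) * (2 * (2 / real (N - k)))"
          unfolding f_eq isum abs_mult by (intro mult_mono) (auto simp: abs_mult power_abs)
        also have "\<dots> = 2 / real (Suc N) * (inverse (real (Suc k)) + inverse (real (N - k)))"
        proof -
          have "1 / (2 * x) * (2 * (2 / y)) = 2 / (x + y) * (inverse x + inverse y)"
            if "x > 0" "y > 0" for x y :: real
          proof -
            have "inverse x + inverse y = (x + y) / (x * y)"
              using that by (simp add: field_simps)
            moreover have "x + y \<noteq> 0"
              using that by simp
            ultimately show ?thesis
              by (simp del: distrib_left_numeral)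
          qed
          from this[of "real (Suc k)" "real (N - k)"] show ?thesis
            using that by (simp add: of_nat_diff)
        qed
        finally show ?thesis .
      qed
      then have "norm (\<Sum>k<N. ?f N k) \<le>
          (\<Sum>k<N. 2 / real (Suc N) * (inverse (real (Suc k)) + inverse (real (N - k))))"
        by (intro sum_norm_le) auto
      also have "\<dots> = 2 / real (Suc N) * ((\<Sum>k<N. inverse (real (Suc k))) + (\<Sum>k<N. inverse (real (N - k))))"
        unfolding sum_distrib_left[symmetric] sum.distrib ..
      also have "(\<Sum>k<N. inverse (real (N - k))) = (\<Sum>k<N. inverse (real (Suc k)))"
        by (subst sum.nat_diff_reindex[symmetric]) (auto intro!: sum.cong)
      also have "(\<Sum>k<N. inverse (real (Suc k))) = harm N"
        by (induction N) (auto simp: harm_Suc harm_def[of 0])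
      also have "2 / real (Suc N) * (harm N + harm N) \<le> 2 / real (Suc N) * (4 * sqrt (real (Suc N)))"
      proof -
        have "sqrt (real N) \<le> sqrt (real (Suc N))"
          by simp
        then have "harm N + harm N \<le> 4 * sqrt (real (Suc N))"
          using harm_le_sqrt[of N] by linarith
        then show ?thesis
          by (intro mult_left_mono) auto
      qed
      also have "\<dots> = 8 / sqrt (real (Suc N))"
        using real_div_sqrt[of "real (Suc N)"] by (simp add: field_simps del: of_nat_Suc)
      finally show ?thesis .
    qed
    then show "\<forall>\<^sub>F N in sequentially. norm (\<Sum>k<N. ?f N k) \<le> 8 / sqrt (real (Suc N))"
      by simp
    show "(\<lambda>N. 8 / sqrt (real (Suc N))) \<longlonglongrightarrow> 0"
      by (rule LIMSEQ_Suc, intro real_tendsto_divide_at_top[OF tendsto_const]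
          filterlim_compose[OF sqrt_at_top filterlim_real_sequentially])
  qed
  moreover have "(\<lambda>N. suminf (g N)) \<longlonglongrightarrow> 0"
  proof -
    have "(\<lambda>N. g N j) \<longlonglongrightarrow> 0" for j
    proof (rule Lim_null_comparison)
      show "\<forall>\<^sub>F N in sequentially. norm (g N j) \<le> 2 / (real j + 1) * (1 / real (Suc (j + N)))"
        using g_bound by simp
      have "(\<lambda>N. 1 / real (Suc (N + j))) \<longlonglongrightarrow> 0"
        by (rule LIMSEQ_ignore_initial_segment[OF LIMSEQ_Suc[OF lim_inverse_n']])
      from tendsto_mult_right_zero[OF this, of "2 / (real j + 1)"]
      show "(\<lambda>N. 2 / (real j + 1) * (1 / real (Suc (j + N)))) \<longlonglongrightarrow> 0"
        by (simp add: add.commute)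
    qed
    moreover have "eventually (\<lambda>(j, N). norm (g N j) \<le> M j) (at_top \<times>\<^sub>F sequentially)"
      by (intro always_eventually) (use g_M in auto)
    ultimately show ?thesis
      using tannerys_theorem[of "\<lambda>j N. g N j" "\<lambda>_. 0" sequentially M] M by simp
  qed
  moreover have "(\<lambda>N. suminf (\<lambda>j. a (j + N))) \<longlonglongrightarrow> 0"
  proof -
    have "(\<lambda>N. suminf a - (\<Sum>k<N. a k)) \<longlonglongrightarrow> suminf a - suminf a"
      by (intro tendsto_intros summable_LIMSEQ a_sum)
    then show ?thesis
      by (simp add: suminf_minus_initial_segment[OF a_sum])
  qed
  ultimately have "(\<lambda>N. (\<Sum>k<N. ?f N k) + (suminf (g N) - L * suminf (\<lambda>j. a (j + N)))) \<longlonglongrightarrow> 0 + (0 - L * 0)"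
    by (intro tendsto_intros)
  then show "(\<lambda>N. suminf (?f N)) \<longlonglongrightarrow> 0"
    unfolding f_suminf by simp
qed

subsection \<open>Comparison of rows and columns\<close>

abbreviation even_powers_sum :: "real \<Rightarrow> nat \<Rightarrow> (nat \<Rightarrow> real) \<Rightarrow> nat \<Rightarrow> real" where
  "even_powers_sum s p h M \<equiv> (\<Sum>m=1..M. s ^ m * h m / (2 * real m) ^ p)"

text \<open>An exact identity of finite sums: after exchanging the order of summation,
  \<open>shifted_odd_sum\<close> evaluates each row. The limits are taken later, first in
  \<open>M\<close>, then in \<open>N\<close>.\<close>

lemma rows_eq_columns:
  assumes s: "s1 \<in> {1, -1}" "s2 \<in> {1, -1}" and parity: "s2 * (-1) ^ (p + q) = -1"
  shows "(\<Sum>n=1..N. s2 ^ n * (\<Sum>m=1..M.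
            (s1 * s2) ^ m / ((2 * real m) ^ p * (2 * real n - 1 - 2 * real m) ^ q) +
            (s1 * s2) ^ m / ((- 2 * real m) ^ p * (2 * real n - 1 + 2 * real m) ^ q)))
       = (\<Sum>m=1..M. row_error s1 s2 p q N m)
         + odd_psum s2 q N * (\<Sum>m=1..M. s1 ^ m / (2 * real m) ^ p + s1 ^ m / (- 2 * real m) ^ p)
         - 2 * (-1) ^ p * even_powers_sum s1 p (odd_psum s2 q) M"
proof -
  let ?t = "s1 * s2"
  define R where "R m = (\<Sum>n=1..N. s2 ^ n / (2 * real n - 1 - 2 * of_int m) ^ q)" for m :: int
  have neg: "(- 2 * real m) ^ p = (-1) ^ p * (2 * real m) ^ p" for m
    by (metis power_mult_distrib mult_minus_left mult_1_left)
  \<comment> \<open>Here the parity hypothesis enters: it turns \<open>h (- m)\<close> into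
    \<open>(-1) ^ p * h m\<close>, so that the rows \<open>m\<close> and \<open>- m\<close>
    contribute equal terms instead of cancelling.\<close>
  have e: "(-1) ^ p = - s2 * (-1) ^ q"
    using parity s(2) by (auto simp: power_add minus_one_power_iff split: if_splits)
  have row: "?t ^ m / (2 * real m) ^ p * R (int m) + ?t ^ m / (- 2 * real m) ^ p * R (- int m)
      = row_error s1 s2 p q N m
        + odd_psum s2 q N * (s1 ^ m / (2 * real m) ^ p + s1 ^ m / (- 2 * real m) ^ p)
        - 2 * (-1) ^ p * (s1 ^ m * odd_psum s2 q m / (2 * real m) ^ p)" for m
  proof -
    have t: "?t ^ m * s2 ^ m = s1 ^ m"
      using sign_powi(2)[OF s(2), of "int m"] by (simp add: power_mult_distrib mult.assoc)
    have "odd_isum s2 q (- int m) = (-1) ^ p * odd_psum s2 q m"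
      by (simp only: odd_isum_minus[OF s(2)] odd_isum_of_nat e)
    then have 1: "R (int m) = s2 ^ m * (odd_isum s2 q (int N - int m) - (-1) ^ p * odd_psum s2 q m)"
      unfolding R_def shifted_odd_sum[OF s(2)] by simp
    have "int N - - int m = int (N + m)"
      by simp
    then have 2: "R (- int m) = s2 ^ m * (odd_psum s2 q (N + m) - odd_psum s2 q m)"
      unfolding R_def shifted_odd_sum[OF s(2)] sign_powi(1)[OF s(2)]
      by (simp only: odd_isum_of_nat minus_minus power_int_of_nat)
    define d e where "d = (2 * real m) ^ p" and "e = ((-1) ^ p :: real)"
    have div_e: "x / (e * d) = e * (x / d)" for x
      by (cases "even p") (simp_all add: e_def)
    have "?t ^ m / d * R (int m) + ?t ^ m / (e * d) * R (- int m) = ?t ^ m * s2 ^ m / d *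
        (odd_isum s2 q (int N - int m) - e * odd_psum s2 q m + e * (odd_psum s2 q (N + m) - odd_psum s2 q m))"
      unfolding 1 2 div_e e_def[symmetric] by (simp only: times_divide_eq_left[symmetric]) algebra
    also have "\<dots> = row_error s1 s2 p q N m + odd_psum s2 q N * (s1 ^ m / d + s1 ^ m / (e * d))
        - 2 * e * (s1 ^ m * odd_psum s2 q m / d)"
      unfolding t row_error_def d_def[symmetric] e_def[symmetric] div_e
      by (simp add: ring_distribs add_divide_distrib diff_divide_distrib mult_ac)
    finally show ?thesis
      unfolding neg d_def e_def .
  qed
  have "(\<Sum>n=1..N. s2 ^ n * (\<Sum>m=1..M.
            ?t ^ m / ((2 * real m) ^ p * (2 * real n - 1 - 2 * real m) ^ q) +
            ?t ^ m / ((- 2 * real m) ^ p * (2 * real n - 1 + 2 * real m) ^ q)))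
      = (\<Sum>n=1..N. \<Sum>m=1..M.
            ?t ^ m / (2 * real m) ^ p * (s2 ^ n / (2 * real n - 1 - 2 * of_int (int m)) ^ q) +
            ?t ^ m / (- 2 * real m) ^ p * (s2 ^ n / (2 * real n - 1 - 2 * of_int (- int m)) ^ q))"
    by (simp add: sum_distrib_left ring_distribs mult_ac)
  also have "\<dots> = (\<Sum>m=1..M. ?t ^ m / (2 * real m) ^ p * R (int m) + ?t ^ m / (- 2 * real m) ^ p * R (- int m))"
    unfolding R_def by (subst sum.swap) (simp only: sum.distrib sum_distrib_left)
  also have "\<dots> = (\<Sum>m=1..M. row_error s1 s2 p q N m
        + odd_psum s2 q N * (s1 ^ m / (2 * real m) ^ p + s1 ^ m / (- 2 * real m) ^ p)
        - 2 * (-1) ^ p * (s1 ^ m * odd_psum s2 q m / (2 * real m) ^ p))"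
    by (intro sum.cong refl row)
  also have "\<dots> = (\<Sum>m=1..M. row_error s1 s2 p q N m)
         + odd_psum s2 q N * (\<Sum>m=1..M. s1 ^ m / (2 * real m) ^ p + s1 ^ m / (- 2 * real m) ^ p)
         - 2 * (-1) ^ p * even_powers_sum s1 p (odd_psum s2 q) M"
    by (simp only: sum_subtractf sum.distrib[of _ "\<lambda>m. odd_psum s2 q N * _ m"] sum_distrib_left)
  finally show ?thesis .
qed

text \<open>The shift \<open>n1 = m + 1\<close> turns \<open>2 * n1 - 2\<close> into
  \<open>2 * m\<close> and leaves one extra sign in front; \<open>n1 = 1\<close> contributes
  nothing.\<close>

lemma double_T_partial_Suc:
  fixes \<sigma>1 \<sigma>2 :: int
  shows "double_T_partial p q \<sigma>1 \<sigma>2 (Suc M)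
    = 4 * of_int \<sigma>1 * even_powers_sum (of_int \<sigma>1) p (odd_psum (of_int \<sigma>2) q) M"
proof -
  have inner: "(\<Sum>n=1..<Suc m. (of_int \<sigma>1 ^ Suc m * of_int \<sigma>2 ^ n) / ((2 * real (Suc m) - 2) ^ p * (2 * real n - 1) ^ q))
      = of_int \<sigma>1 * (of_int \<sigma>1 ^ m * odd_psum (of_int \<sigma>2) q m / (2 * real m) ^ p)" for m
    by (simp add: odd_psum_def atLeastLessThanSuc_atLeastAtMost sum_distrib_left sum_divide_distrib mult_ac)
  have "(\<Sum>n1=1..Suc M. \<Sum>n2=1..<n1. (of_int \<sigma>1 ^ n1 * of_int \<sigma>2 ^ n2) / ((2 * real n1 - 2) ^ p * (2 * real n2 - 1) ^ q))
     = (\<Sum>m=1..M. \<Sum>n=1..<Suc m. (of_int \<sigma>1 ^ Suc m * of_int \<sigma>2 ^ n) / ((2 * real (Suc m) - 2) ^ p * (2 * real n - 1) ^ q))"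
    by (induction M) (simp, simp only: sum.cl_ivl_Suc, simp)
  then show ?thesis
    unfolding double_T_partial_def inner by (simp add: sum_distrib_left mult_ac)
qed

section \<open>Limits that are polynomials in the generators\<close>

definition T_generators :: "real set" where
  "T_generators = {pi, catalan_const} \<union> {zeta_value k | k. odd k \<and> k \<ge> 3}
             \<union> {dirichlet_beta k | k. even k \<and> k \<ge> 4}"

text \<open>Convergence and the form of the limit are kept together, so that finite sums of
  sequences can be treated term by term without naming limits.\<close>

definition tends_to_T_polynomial :: "(nat \<Rightarrow> real) \<Rightarrow> bool" where
  "tends_to_T_polynomial f \<longleftrightarrow> (\<exists>x. is_rat_poly_in x T_generators \<and> f \<longlonglongrightarrow> x)"

lemma tends_to_T_polynomial_add:
  "tends_to_T_polynomial f \<Longrightarrow> tends_to_T_polynomial g \<Longrightarrow> tends_to_T_polynomial (\<lambda>n. f n + g n)"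
  unfolding tends_to_T_polynomial_def by (blast intro: is_rat_poly_in_add tendsto_add)

lemma tends_to_T_polynomial_0: "tends_to_T_polynomial (\<lambda>_. 0)"
  using is_rat_poly_in_monomial[of 0 pi T_generators pi]
  unfolding tends_to_T_polynomial_def T_generators_def by auto

lemma tends_to_T_polynomial_sum:
  "(\<And>i. i \<in> A \<Longrightarrow> tends_to_T_polynomial (f i)) \<Longrightarrow> tends_to_T_polynomial (\<lambda>n. \<Sum>i\<in>A. f i n)"
  by (induction A rule: infinite_finite_induct)
    (simp_all add: tends_to_T_polynomial_0 tends_to_T_polynomial_add)

text \<open>With \<open>c = 0\<close> any \<open>s\<close> and \<open>j\<close> are allowed, even
  where the sums diverge; this is how terms of the wrong parity drop out.\<close>

lemma tends_to_T_polynomial_odd_psum: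
  assumes "c \<in> \<rat>"
    and "c \<noteq> 0 \<Longrightarrow> s = 1 \<and> odd j \<and> j \<ge> 3 \<or> s = -1 \<and> even j \<and> j \<ge> 2"
  shows "tends_to_T_polynomial (\<lambda>n. c * pi ^ i * odd_psum s j n)"
proof -
  have pi: "pi \<in> T_generators"
    by (simp add: T_generators_def)
  consider "c = 0" | "s = 1" "odd j" "j \<ge> 3" | "s = -1" "even j" "j \<ge> 2"
    using assms(2) by auto
  then show ?thesis
  proof cases
    case 1
    then show ?thesis
      by (simp add: tends_to_T_polynomial_0)
  next
    case 2
    have "zeta_value j \<in> T_generators"
      using 2 unfolding T_generators_def by blast
    with pi have "is_rat_poly_in (c * (1 - (1/2) ^ j) * pi ^ i * zeta_value j ^ 1) T_generators"
      using assms(1) by (intro is_rat_poly_in_monomial) auto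
    moreover have "(\<lambda>n. c * pi ^ i * odd_psum s j n) \<longlonglongrightarrow> c * pi ^ i * ((1 - (1/2) ^ j) * zeta_value j)"
      unfolding \<open>s = 1\<close> using 2 by (intro tendsto_mult tendsto_const zeta_value_even_odd) auto
    ultimately show ?thesis
      unfolding tends_to_T_polynomial_def by (simp add: mult_ac) blast
  next
    case 3
    have "dirichlet_beta j \<in> T_generators"
    proof (cases "j = 2")
      case False
      with 3 have "j \<ge> 4"
        by presburger
      with 3 show ?thesis
        unfolding T_generators_def by blast
    qed (simp add: T_generators_def catalan_const_def)
    with pi have "is_rat_poly_in (- c * pi ^ i * dirichlet_beta j ^ 1) T_generators"
      using assms(1) by (intro is_rat_poly_in_monomial) auto
    moreover have "(\<lambda>n. c * pi ^ i * odd_psum s j n) \<longlonglongrightarrow> c * pi ^ i * - dirichlet_beta j"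
      unfolding \<open>s = -1\<close> using 3 by (intro tendsto_mult tendsto_const odd_psum_alternating_limit) auto
    ultimately show ?thesis
      unfolding tends_to_T_polynomial_def by auto
  qed
qed

lemma even_powers_sum_limit:
  assumes s: "s1 \<in> {1, -1}" "s2 \<in> {1, -1}" and pq: "p \<ge> 1" "q \<ge> 1" "p \<ge> 2 \<or> s1 = -1"
    and parity: "s2 * (-1) ^ (p + q) = -1"
  obtains l where "is_rat_poly_in l T_generators" "even_powers_sum s1 p (odd_psum s2 q) \<longlonglongrightarrow> l"
proof -
  define t w where "t = s1 * s2" and "w = p + q"
  have t: "t \<in> {1, -1}"
    using s by (auto simp: t_def)
  have parity_cases: "s2 = 1 \<and> odd w \<or> s2 = -1 \<and> even w"
    using s parity by (auto simp: w_def minus_one_power_iff split: if_splits)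
  obtain c d :: "nat \<Rightarrow> nat" where cp: "c p = 1" and
    pf: "\<And>x y :: real. x \<noteq> 0 \<Longrightarrow> y \<noteq> 0 \<Longrightarrow> x + y \<noteq> 0 \<Longrightarrow> 1 / (x ^ p * y ^ q) =
        (\<Sum>i=1..p. real (c i) / (x ^ i * (x + y) ^ (p + q - i))) +
        (\<Sum>i=1..q. real (d i) / (y ^ i * (x + y) ^ (p + q - i)))"
    using partial_fractions_powers[of p q] pq by auto
  have "\<exists>u. \<forall>i. i \<ge> 1 \<longrightarrow> u i \<in> \<rat> \<and> (odd i \<longrightarrow> u i = 0) \<and>
    (\<lambda>M. \<Sum>m=1..M. t ^ m / (2 * real m) ^ i + t ^ m / (- 2 * real m) ^ i) \<longlonglongrightarrow> u i * pi ^ i"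
    using two_sided_even_sum_limit[OF t] by (intro choice) blast
  then obtain u where u: "\<And>i. i \<ge> 1 \<Longrightarrow> u i \<in> \<rat> \<and> (odd i \<longrightarrow> u i = 0) \<and>
    (\<lambda>M. \<Sum>m=1..M. t ^ m / (2 * real m) ^ i + t ^ m / (- 2 * real m) ^ i) \<longlonglongrightarrow> u i * pi ^ i"
    by blast
  have "\<exists>v. \<forall>i. i \<ge> 1 \<longrightarrow> v i \<in> \<rat> \<and> (t * (-1) ^ i \<noteq> 1 \<longrightarrow> v i = 0) \<and> (\<forall>n.
    (\<lambda>M. \<Sum>m=1..M. t ^ m / (2 * real n - 1 - 2 * real m) ^ i + t ^ m / (2 * real n - 1 + 2 * real m) ^ i)
      \<longlonglongrightarrow> t ^ n * (v i * pi ^ i) - 1 / (2 * real n - 1) ^ i)"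
    using two_sided_odd_sum_limit[OF t] by (intro choice) blast
  then obtain v where v: "\<And>i. i \<ge> 1 \<Longrightarrow> v i \<in> \<rat> \<and> (t * (-1) ^ i \<noteq> 1 \<longrightarrow> v i = 0) \<and> (\<forall>n.
    (\<lambda>M. \<Sum>m=1..M. t ^ m / (2 * real n - 1 - 2 * real m) ^ i + t ^ m / (2 * real n - 1 + 2 * real m) ^ i)
      \<longlonglongrightarrow> t ^ n * (v i * pi ^ i) - 1 / (2 * real n - 1) ^ i)"
    by blast
  have u_rat: "u i \<in> \<rat>" and u_odd: "odd i \<Longrightarrow> u i = 0"
    and v_rat: "v i \<in> \<rat>" and v_zero: "t * (-1) ^ i \<noteq> 1 \<Longrightarrow> v i = 0" if "i \<ge> 1" for i
    using u[OF that] v[OF that] by blast+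
  obtain r where r: "r \<in> \<rat>" "odd p \<Longrightarrow> r = 0" and r_lim:
    "(\<lambda>M. \<Sum>m=1..M. s1 ^ m / (2 * real m) ^ p + s1 ^ m / (- 2 * real m) ^ p) \<longlonglongrightarrow> r * pi ^ p"
    using two_sided_even_sum_limit[OF s(1) pq(1)] by blast
  \<comment> \<open>For \<open>s2 = 1\<close> the row side and the column side contain the same
    two-sided sum. Its multiples of \<open>odd_psum 1 q\<close> therefore cancel, which is essential
    when \<open>q = 1\<close>.\<close>
  have r_eq: "r = u p" if "s2 = 1"
  proof -
    have "t = s1"
      using that by (simp add: t_def)
    then have "r * pi ^ p = u p * pi ^ p"
      using u[OF pq(1)] by (intro LIMSEQ_unique[OF r_lim]) blast
    then show ?thesis
      by simp
  qed

  let ?S = "even_powers_sum s1 p (odd_psum s2 q)"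
  let ?e = "\<lambda>N k. row_error s1 s2 p q N (Suc k)"
  have e_sum: "summable (?e N)" and e_lim: "(\<lambda>N. suminf (?e N)) \<longlonglongrightarrow> 0" for N
  proof -
    have "summable (?e N) \<and> (\<lambda>N. suminf (?e N)) \<longlonglongrightarrow> 0"
    proof (cases "p \<ge> 2")
      case True
      then show ?thesis
        using row_error_sum_tendsto_0_absolute[OF s pq(2)] by blast
    next
      case False
      then have "p = 1" "s1 = -1"
        using pq by auto
      moreover have "s2 * (-1) ^ q = 1"
        using parity \<open>p = 1\<close> by simp
      ultimately show ?thesis
        using row_error_sum_tendsto_0_alternating[OF s(2) pq(2)] by blast
    qed
    then show "summable (?e N)" "(\<lambda>N. suminf (?e N)) \<longlonglongrightarrow> 0"
      by auto
  qed
  have e_sums: "(\<lambda>M. \<Sum>m=1..M. row_error s1 s2 p q N m) \<longlonglongrightarrow> suminf (?e N)" for N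
    using summable_LIMSEQ[OF e_sum] by (simp add: sum.atLeast1_atMost_eq)
  note identity = rows_eq_columns[OF s parity]

  \<comment> \<open>For \<open>N = 0\<close> there are no columns and
    \<open>odd_psum s2 q 0 = 0\<close>, so the identity expresses the partial sums of the double
    series through row errors alone. Their summability proves its convergence, also for
    \<open>p = 1\<close>.\<close>
  define l where "l = (-1) ^ p / 2 * suminf (?e 0)"
  have sgn: "(-1) ^ p / 2 * (2 * (-1) ^ p * z) = (z :: real)" for z
    by (cases "even p") simp_all
  have S_lim: "?S \<longlonglongrightarrow> l"
  proof -
    have "?S M = (-1) ^ p / 2 * (\<Sum>m=1..M. row_error s1 s2 p q 0 m)" for M
    proof -
      have "(\<Sum>m=1..M. row_error s1 s2 p q 0 m) = 2 * (-1) ^ p * ?S M"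
        using identity[where N = 0 and M = M] by simp
      then show ?thesis
        by (simp only: sgn)
    qed
    then show ?thesis
      unfolding l_def by (simp only:) (intro tendsto_mult tendsto_const e_sums)
  qed

  define x where "x n =
    (\<Sum>i=1..p. real (c i) * (u i * pi ^ i) / (2 * real n - 1) ^ (p + q - i)) +
    (\<Sum>i=1..q. real (d i) * (t ^ n * (v i * pi ^ i) / (2 * real n - 1) ^ (p + q - i) - 1 / (2 * real n - 1) ^ (p + q)))" for n
  have column: "(\<lambda>M. \<Sum>m=1..M. t ^ m / ((2 * real m) ^ p * (2 * real n - 1 - 2 * real m) ^ q) +
                        t ^ m / ((- 2 * real m) ^ p * (2 * real n - 1 + 2 * real m) ^ q)) \<longlonglongrightarrow> x n"
    if "n \<ge> 1" for n
    unfolding x_def using u v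
    by (intro column_sum_limit[OF t pq(1,2) that pf]) blast+
  \<comment> \<open>Both sides are limits in \<open>M\<close> of the same finite double sum, taken
    by columns and by rows.\<close>
  have "(\<Sum>n=1..N. s2 ^ n * x n) = suminf (?e N) + odd_psum s2 q N * (r * pi ^ p) - 2 * (-1) ^ p * l" for N
  proof (rule LIMSEQ_unique)
    show "(\<lambda>M. \<Sum>n=1..N. s2 ^ n * (\<Sum>m=1..M.
        t ^ m / ((2 * real m) ^ p * (2 * real n - 1 - 2 * real m) ^ q) +
        t ^ m / ((- 2 * real m) ^ p * (2 * real n - 1 + 2 * real m) ^ q))) \<longlonglongrightarrow> (\<Sum>n=1..N. s2 ^ n * x n)"
      by (intro tendsto_sum tendsto_mult tendsto_const column) auto
    show "(\<lambda>M. \<Sum>n=1..N. s2 ^ n * (\<Sum>m=1..M.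
        t ^ m / ((2 * real m) ^ p * (2 * real n - 1 - 2 * real m) ^ q) +
        t ^ m / ((- 2 * real m) ^ p * (2 * real n - 1 + 2 * real m) ^ q)))
      \<longlonglongrightarrow> suminf (?e N) + odd_psum s2 q N * (r * pi ^ p) - 2 * (-1) ^ p * l"
      unfolding t_def identity
      by (intro tendsto_add tendsto_diff tendsto_mult tendsto_const e_sums r_lim S_lim)
  qed
  then have "odd_psum s2 q N * (r * pi ^ p) - (\<Sum>n=1..N. s2 ^ n * x n) = 2 * (-1) ^ p * l - suminf (?e N)" for N
    by simp
  then have l_lim: "(\<lambda>N. odd_psum s2 q N * (r * pi ^ p) - (\<Sum>n=1..N. s2 ^ n * x n)) \<longlonglongrightarrow> 2 * (-1) ^ p * l"
    using tendsto_diff[OF tendsto_const e_lim, of "2 * (-1) ^ p * l"] by simp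

  have x_sum: "(\<Sum>n=1..N. s2 ^ n * x n) =
      (\<Sum>i=1..p. real (c i) * u i * pi ^ i * odd_psum s2 (w - i) N) +
      (\<Sum>i=1..q. real (d i) * v i * pi ^ i * odd_psum s1 (w - i) N - real (d i) * odd_psum s2 w N)" for N
  proof -
    \<comment> \<open>This product of signs explains why the terms with \<open>v i\<close> lead to
      sums with sign \<open>s1\<close> instead of \<open>s2\<close>.\<close>
    have st: "s2 ^ n * t ^ n = s1 ^ n" for n
      using s by (auto simp: t_def power_mult_distrib[symmetric])
    have "s2 ^ n * x n =
      (\<Sum>i=1..p. real (c i) * u i * pi ^ i * (s2 ^ n / (2 * real n - 1) ^ (w - i))) +
      (\<Sum>i=1..q. real (d i) * v i * pi ^ i * (s1 ^ n / (2 * real n - 1) ^ (w - i)) -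
         real (d i) * (s2 ^ n / (2 * real n - 1) ^ w))" for n
    proof -
      have "s2 ^ n * (real (d i) * (t ^ n * (v i * pi ^ i) / (2 * real n - 1) ^ (w - i) - 1 / (2 * real n - 1) ^ w))
        = real (d i) * v i * pi ^ i * (s2 ^ n * t ^ n / (2 * real n - 1) ^ (w - i)) -
          real (d i) * (s2 ^ n / (2 * real n - 1) ^ w)" for i
        by (simp add: algebra_simps)
      note v_terms = this[unfolded st]
      have u_terms: "s2 ^ n * (real (c i) * (u i * pi ^ i) / (2 * real n - 1) ^ (w - i))
        = real (c i) * u i * pi ^ i * (s2 ^ n / (2 * real n - 1) ^ (w - i))" for i
        by simp
      show ?thesis
        unfolding x_def w_def[symmetric] distrib_left sum_distrib_left v_terms u_terms ..
    qed
    then have "(\<Sum>n=1..N. s2 ^ n * x n) =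
      (\<Sum>n=1..N. \<Sum>i=1..p. real (c i) * u i * pi ^ i * (s2 ^ n / (2 * real n - 1) ^ (w - i))) +
      (\<Sum>n=1..N. \<Sum>i=1..q. real (d i) * v i * pi ^ i * (s1 ^ n / (2 * real n - 1) ^ (w - i)) -
         real (d i) * (s2 ^ n / (2 * real n - 1) ^ w))"
      by (simp only: sum.distrib)
    also have "\<dots> =
      (\<Sum>i=1..p. \<Sum>n=1..N. real (c i) * u i * pi ^ i * (s2 ^ n / (2 * real n - 1) ^ (w - i))) +
      (\<Sum>i=1..q. \<Sum>n=1..N. real (d i) * v i * pi ^ i * (s1 ^ n / (2 * real n - 1) ^ (w - i)) -
         real (d i) * (s2 ^ n / (2 * real n - 1) ^ w))"
      by (intro arg_cong2[where f = "(+)"] sum.swap)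
    finally show ?thesis
      by (simp only: odd_psum_def sum_subtractf sum_distrib_left)
  qed

  have three: "3 \<le> n" if "odd n" "2 \<le> n" for n :: nat
    using that by presburger
  have two: "2 \<le> n" if "even n" "1 \<le> n" for n :: nat
    using that by presburger
  \<comment> \<open>Each summand has coefficient 0 or a sum tending to a multiple of an admissible
    zeta or beta value. The term \<open>i = p\<close> of the first sum is merged with the one
    containing \<open>r\<close>.\<close>
  have "tends_to_T_polynomial (\<lambda>N. (r - u p) * pi ^ p * odd_psum s2 q N
      + (\<Sum>i\<in>{1..<p}. - (real (c i) * u i) * pi ^ i * odd_psum s2 (w - i) N)
      + (\<Sum>i=1..q. - (real (d i) * v i) * pi ^ i * odd_psum s1 (w - i) N + real (d i) * pi ^ 0 * odd_psum s2 w N))"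
  proof (intro tends_to_T_polynomial_add tends_to_T_polynomial_sum tends_to_T_polynomial_odd_psum)
    show "r - u p \<in> \<rat>" "real (d i) \<in> \<rat>" for i
      using r(1) u_rat[OF pq(1)] by auto
    show "- (real (c i) * u i) \<in> \<rat>" if "i \<in> {1..<p}" for i
      using u_rat[of i] that by auto
    show "- (real (d i) * v i) \<in> \<rat>" if "i \<in> {1..q}" for i
      using v_rat[of i] that by auto
    show "s2 = 1 \<and> odd w \<and> w \<ge> 3 \<or> s2 = -1 \<and> even w \<and> w \<ge> 2"
    proof -
      have "w \<ge> 2"
        using pq by (simp add: w_def)
      with parity_cases show ?thesis
        by (auto intro: three)
    qed
    show "s2 = 1 \<and> odd q \<and> q \<ge> 3 \<or> s2 = -1 \<and> even q \<and> q \<ge> 2" if "r - u p \<noteq> 0"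
    proof -
      have "s2 = -1"
        using that r_eq s by auto
      moreover have "even p"
        using that r(2) u_odd[OF pq(1)] by (cases "even p") auto
      ultimately show ?thesis
        using parity_cases pq(2) by (auto simp: w_def intro: two)
    qed
    \<comment> \<open>Only even \<open>i\<close> survive, so \<open>w - i\<close> keeps the parity
      of \<open>w\<close>; it is at least 2 because \<open>i < p\<close> and \<open>q\<close> is
      positive.\<close>
    show "s2 = 1 \<and> odd (w - i) \<and> w - i \<ge> 3 \<or> s2 = -1 \<and> even (w - i) \<and> w - i \<ge> 2"
      if i: "i \<in> {1..<p}" and nz: "- (real (c i) * u i) \<noteq> 0" for i
    proof -
      have "even i"
        using nz u_odd[of i] i by auto
      then have "even (w - i) \<longleftrightarrow> even w"
        using i by (simp add: w_def)
      moreover have "w - i \<ge> 2"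
        using i pq by (auto simp: w_def)
      ultimately show ?thesis
        using parity_cases by (auto intro: three)
    qed
    \<comment> \<open>Multiplying \<open>t * (-1) ^ i = 1\<close> by the parity hypothesis gives
      \<open>s1 * (-1) ^ (w - i) = -1\<close>. The exponent is at least \<open>p\<close>, and
      \<open>s1 = 1\<close> occurs only with \<open>p\<close> at least 2, so no divergent sum
      appears.\<close>
    show "s1 = 1 \<and> odd (w - i) \<and> w - i \<ge> 3 \<or> s1 = -1 \<and> even (w - i) \<and> w - i \<ge> 2"
      if i: "i \<in> {1..q}" and nz: "- (real (d i) * v i) \<noteq> 0" for i
    proof -
      have "t * (-1) ^ i = 1"
        using nz v_zero[of i] i by auto
      then have "s1 = 1 \<and> odd (w - i) \<or> s1 = -1 \<and> even (w - i)"
        using s parity_cases i by (auto simp: t_def w_def minus_one_power_iff split: if_splits)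
      moreover have "w - i \<ge> p"
        using i by (auto simp: w_def)
      then have "w - i \<ge> 1" "s1 = 1 \<Longrightarrow> w - i \<ge> 2"
        using pq by auto
      ultimately show ?thesis
        using three two by blast
    qed
  qed
  moreover have "odd_psum s2 q N * (r * pi ^ p) - (\<Sum>n=1..N. s2 ^ n * x n) =
      (r - u p) * pi ^ p * odd_psum s2 q N
      + (\<Sum>i\<in>{1..<p}. - (real (c i) * u i) * pi ^ i * odd_psum s2 (w - i) N)
      + (\<Sum>i=1..q. - (real (d i) * v i) * pi ^ i * odd_psum s1 (w - i) N + real (d i) * pi ^ 0 * odd_psum s2 w N)" for N
  proof -
    \<comment> \<open>The term \<open>i = p\<close> has coefficient \<open>c p = 1\<close> and
      exponent \<open>w - p = q\<close>, which allows the merging with \<open>r\<close>.\<close>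
    have "{1..p} = insert p {1..<p}"
      using pq by auto
    then have "(\<Sum>i=1..p. real (c i) * u i * pi ^ i * odd_psum s2 (w - i) N) =
        u p * pi ^ p * odd_psum s2 q N + (\<Sum>i\<in>{1..<p}. real (c i) * u i * pi ^ i * odd_psum s2 (w - i) N)"
      using cp by (simp add: w_def)
    then show ?thesis
      unfolding x_sum by (simp add: sum_negf sum_subtractf sum.distrib algebra_simps)
  qed
  ultimately obtain y where y: "is_rat_poly_in y T_generators"
    "(\<lambda>N. odd_psum s2 q N * (r * pi ^ p) - (\<Sum>n=1..N. s2 ^ n * x n)) \<longlonglongrightarrow> y"
    unfolding tends_to_T_polynomial_def by auto
  have "y = 2 * (-1) ^ p * l"
    using LIMSEQ_unique[OF y(2) l_lim] .
  then have "l = (-1) ^ p / 2 * y"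
    by (simp only: sgn)
  moreover have "is_rat_poly_in ((-1) ^ p / 2 * y) T_generators"
    by (intro is_rat_poly_in_scale y(1)) simp
  ultimately have "is_rat_poly_in l T_generators"
    by (simp only:)
  then show ?thesis
    using S_lim that by blast
qed

theorem theorem3p10:
  fixes p q :: nat and \<sigma>1 \<sigma>2 :: int
  assumes "p \<ge> 1" and "q \<ge> 1"
    and "\<sigma>1 \<in> {1, -1}" and "\<sigma>2 \<in> {1, -1}"
    and "(p, \<sigma>1) \<noteq> (1, 1)"
    and "even (p + q) \<longleftrightarrow> even ((1 + \<sigma>2) div 2)"
  shows "is_rat_poly_in (double_T p q \<sigma>1 \<sigma>2)
           ({pi, catalan_const} \<union> {zeta_value k | k. odd k \<and> k \<ge> 3}
             \<union> {dirichlet_beta k | k. even k \<and> k \<ge> 4})"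
proof -
  let ?s1 = "real_of_int \<sigma>1" and ?s2 = "real_of_int \<sigma>2"
  have signs: "?s1 \<in> {1, -1}" "?s2 \<in> {1, -1}"
    using assms by auto
  have "p \<ge> 2 \<or> ?s1 = -1"
    using assms by (cases "p = 1") auto
  \<comment> \<open>The integer \<open>(1 + \<sigma>2) div 2\<close> is 1 or 0 according to the
    sign, so the weight is odd for sign 1 and even for sign -1.\<close>
  moreover have "?s2 * (-1) ^ (p + q) = -1"
    using assms by (auto simp: minus_one_power_iff)
  ultimately obtain l where l: "is_rat_poly_in l T_generators"
    "even_powers_sum ?s1 p (odd_psum ?s2 q) \<longlonglongrightarrow> l"
    by (rule even_powers_sum_limit[OF signs assms(1,2)])
  have "(\<lambda>M. double_T_partial p q \<sigma>1 \<sigma>2 (Suc M)) \<longlonglongrightarrow> 4 * ?s1 * l"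
    unfolding double_T_partial_Suc by (intro tendsto_mult tendsto_const l(2))
  \<comment> \<open>Shifting the truncation index by one does not change the limit, and convergence
    makes \<open>lim\<close> the actual value.\<close>
  then have "double_T p q \<sigma>1 \<sigma>2 = 4 * ?s1 * l"
    unfolding double_T_def filterlim_sequentially_Suc by (rule limI)
  then show ?thesis
    using is_rat_poly_in_scale[OF _ l(1), of "4 * ?s1"] by (simp add: T_generators_def)
qed

end
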